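(* For every $T\in\mathbb R_+$ and $a\in\mathcal A$, the function $\vec\pi\mapsto U(T,\vec\pi,a)$ is convex on $D$.
   Context: Model. $E=\{1,\dots,m\}$ (states) and $\mathcal A=\{1,\dots,A\}$ (policies) are finite sets. $M=(M_t)_{t\ge0}$ is an unobserved continuous-time Markov chain on $E$ with generator $Q=(q_{ij})_{i,j\in E}$. $\lambda_1,\dots,\lambda_m>0$ are constants, $\nu_1,\dots,\nu_m$ are probability distributions on $\mathbb R^d$, $\nu=\nu_1+\cdots+\nu_m$, and $f_i=d\nu_i/d\nu$. The observed process is $X_t=X_0+\int_0^t\sum_{i\in E}1_{\{M_s=i\}}\,dX^{(i)}_s$, where $X^{(1)},\dots,X^{(m)}$ are independent compound Poisson processes, independent of $M$, $X^{(i)}$ having intensity $\lambda_i$ and jump distribution $\nu_i$. $0=\sigma_0<\sigma_1<\sigma_2<\cdots$ are the arrival (jump) times of $X$ and $Y_\ell=X_{\sigma_\ell}-X_{\sigma_\ell-}$ the marks. $\mathbb F=(\mathcal F^X_t)_{t\ge0}$ is the natural filtration of $X$ augmented by null sets. $D=\{\vec\pi\in[0,1]^m:\pi_1+\cdots+\pi_m=1\}$. Under $\mathbb P^{\vec\pi}$, $M_0$ has law $\vec\pi$; $\mathbb E^{\vec\pi,a}$ is the corresponding expectation, when the initial policy is $a$. Conditional probability process. $\vec\Pi_t=\vec\Pi(t)=(\Pi_1(t),\dots,\Pi_m(t))$ with $\Pi_i(t)=\mathbb P^{\vec\pi}\{M_t=i\mid\mathcal F^X_t\}$, taken in its right-continuous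 version: $\vec\Pi(t)=\vec x(t-\sigma_\ell,\vec\Pi(\sigma_\ell))$ for $\sigma_\ell\le t<\sigma_{\ell+1}$, and $\Pi_i(\sigma_\ell)=\lambda_if_i(Y_\ell)\Pi_i(\sigma_\ell-)/\sum_{j\in E}\lambda_jf_j(Y_\ell)\Pi_j(\sigma_\ell-)$ for $\ell\ge1$, where $x_i(t,\vec\pi)=m_i(t,\vec\pi)/\sum_{j\in E}m_j(t,\vec\pi)$, $\vec m(t,\vec\pi)=\vec\pi\,e^{t(Q-\Lambda)}$, $\Lambda=\mathrm{diag}(\lambda_1,\dots,\lambda_m)$. Costs. $\rho\ge0$ is the discount factor; $c_i(a)\in\mathbb R$ are running benefit rates; switching costs satisfy $K_i(a,b)+K_i(b,c)\ge K_i(a,c)$ and $K_i(a,b)>k_0>0$ for all $i\in E$, $a,b,c\in\mathcal A$, for some constant $k_0$. $C(\vec\pi,a)=\sum_{i\in E}c_i(a)\pi_i$, $K(a,b,\vec\pi)=\sum_{i\in E}K_i(a,b)\pi_i$. Strategies and value function. For $T\in\mathbb R_+=[0,\infty)$, an admissible strategy $\xi\in\mathcal U(T)$ with initial policy $a$ is a sequence $(\tau_k,\xi_k)_{k\ge0}$ with $\tau_0=0$, $\xi_0=a$, $0=\tau_0<\tau_1<\cdots\le T$ $\mathbb F$-stopping times (switching times), $\xi_k$ an $\mathcal A$-valued $\mathcal F^X_{\tau_k}$-measurable random variable, almost surely finitely many switches, and $\mathbb E^{\vec\pi,a}[\sum_{k\ge1}e^{-\rho\tau_k}K(\xi_{k-1},\xi_k,\vec\Pi(\tau_k))]<\infty$;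 it is identified with the process $\xi_t=\xi_k$ for $\tau_k\le t<\tau_{k+1}$. Its performance is $$J^\xi(T,\vec\pi,a)=\mathbb E^{\vec\pi,a}\Big[\int_0^Te^{-\rho t}\sum_{i\in E}c_i(\xi_t)1_{\{M_t=i\}}dt-\sum_{k\ge1}e^{-\rho\tau_k}\sum_{i\in E}K_i(\xi_{k-1},\xi_k)1_{\{M_{\tau_k}=i\}}\Big],$$ equivalently $\mathbb E^{\vec\pi,a}[\int_0^Te^{-\rho t}C(\vec\Pi_t,\xi_t)dt-\sum_{k\ge1}e^{-\rho\tau_k}K(\xi_{k-1},\xi_k,\vec\Pi_{\tau_k})]$. The value function is $U(T,\vec\pi,a)=\sup_{\xi\in\mathcal U(T)}J^\xi(T,\vec\pi,a)$. *)

theory Defs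
  imports "HOL-Probability.Probability"
begin

definition mat_exp :: "real^'s^'s \<Rightarrow> real^'s^'s::finite" where
  "mat_exp A = (\<Sum>n. (1 / fact n) *\<^sub>R (((\<lambda>B. A ** B) ^^ n) (mat 1)))"

definition belief_simplex :: "(real^'s::finite) set" where
  "belief_simplex = {p. (\<forall>i. p $ i \<in> {0..1}) \<and> (\<Sum>i\<in>UNIV. p $ i) = 1}"

text \<open>The pathwise integral of \<open>h\<close> over \<open>(0, t]\<close> against the step path
  \<open>u \<mapsto> (\<Sum>n | 0 < S n \<and> S n \<le> u. Z n)\<close>. The index set is finite unless the
  times \<open>S n\<close> accumulate.\<close>

definition jump_integral ::
    "(real \<Rightarrow> real) \<Rightarrow> (nat \<Rightarrow> real) \<Rightarrow> (nat \<Rightarrow> 'v::real_vector) \<Rightarrow> real \<Rightarrow> 'v" where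
  "jump_integral h S Z t = (\<Sum>n | 0 < S n \<and> S n \<le> t. h (S n) *\<^sub>R Z n)"

primrec jump_time :: "(real \<Rightarrow> 'v::t2_space) \<Rightarrow> nat \<Rightarrow> real" where
  "jump_time x 0 = 0"
| "jump_time x (Suc l) = Inf {t. jump_time x l < t \<and> \<not> (x \<longlongrightarrow> x t) (at_left t)}"

definition jump :: "(real \<Rightarrow> 'v::real_normed_vector) \<Rightarrow> real \<Rightarrow> 'v" where
  "jump x t = x t - Lim (at_left t) x"

text \<open>\<open>'s\<close> is the set of states, \<open>'p\<close> the set of policies, and the observations live in
  \<open>real^'d\<close>. The compound Poisson process number \<open>i\<close> is given by its interarrival times
  \<open>wait i n\<close> and its jump sizes \<open>mark i n\<close>. \<open>law p\<close> is the probability measure under which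
  the chain has initial distribution \<open>p\<close>, and \<open>belief p\<close> is the corresponding
  conditional probability process.\<close>

record ('w, 's::finite, 'd::finite, 'p) model =
  base :: "'w measure"
  law :: "real^'s \<Rightarrow> 'w measure"
  chain :: "real \<Rightarrow> 'w \<Rightarrow> 's"
  obs0 :: "'w \<Rightarrow> real^'d"
  wait :: "'s \<Rightarrow> nat \<Rightarrow> 'w \<Rightarrow> real"
  mark :: "'s \<Rightarrow> nat \<Rightarrow> 'w \<Rightarrow> real^'d"
  belief :: "real^'s \<Rightarrow> real \<Rightarrow> 'w \<Rightarrow> real^'s"
  gen :: "real^'s^'s"
  intensity :: "'s \<Rightarrow> real"
  jump_dist :: "'s \<Rightarrow> (real^'d) measure"
  init_dist :: "(real^'d) measure"
  discount :: real
  benefit :: "'s \<Rightarrow> 'p \<Rightarrow> real"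
  switch_cost :: "'s \<Rightarrow> 'p \<Rightarrow> 'p \<Rightarrow> real"

definition arrival :: "('w, 's::finite, 'd::finite, 'p) model \<Rightarrow> 's \<Rightarrow> nat \<Rightarrow> 'w \<Rightarrow> real" where
  "arrival G i n \<omega> = (\<Sum>k\<le>n. wait G i k \<omega>)"

definition obs :: "('w, 's::finite, 'd::finite, 'p) model \<Rightarrow> real \<Rightarrow> 'w \<Rightarrow> real^'d" where
  "obs G t \<omega> = obs0 G \<omega> +
     (\<Sum>i\<in>UNIV. jump_integral (\<lambda>s. if chain G s \<omega> = i then 1 else 0)
                  (\<lambda>n. arrival G i n \<omega>) (\<lambda>n. mark G i n \<omega>) t)"

text \<open>Time runs through \<open>[0, \<infinity>]\<close>, i.e. \<open>ennreal\<close>, so that stopping times may be infinite.\<close>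

definition raw_filtration :: "('w, 's::finite, 'd::finite, 'p) model \<Rightarrow> ennreal \<Rightarrow> 'w measure" where
  "raw_filtration G t = sigma (space (base G))
     {obs G s -` B \<inter> space (base G) | s B. 0 \<le> s \<and> ennreal s \<le> t \<and> B \<in> sets borel}"

text \<open>The null sets are, as usual, all subsets of null events of the full observation.\<close>

definition obs_null_sets :: "('w, 's::finite, 'd::finite, 'p) model \<Rightarrow> real^'s \<Rightarrow> 'w set set" where
  "obs_null_sets G p =
     {N. \<exists>B \<in> sets (raw_filtration G \<infinity>). N \<subseteq> B \<and> emeasure (law G p) B = 0}"

definition obs_filtration ::
    "('w, 's::finite, 'd::finite, 'p) model \<Rightarrow> real^'s \<Rightarrow> ennreal \<Rightarrow> 'w measure" where
  "obs_filtration G p t =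
     sigma (space (base G)) (sets (raw_filtration G t) \<union> obs_null_sets G p)"

text \<open>Events of the augmented filtration need not belong to \<open>base G\<close>; expectations are
  therefore taken under the completed measure.\<close>

abbreviation cprob :: "('w, 's::finite, 'd::finite, 'p) model \<Rightarrow> real^'s \<Rightarrow> 'w measure" where
  "cprob G p \<equiv> completion (law G p)"

definition total_dist :: "('w, 's::finite, 'd::finite, 'p) model \<Rightarrow> (real^'d) measure" where
  "total_dist G = measure_of UNIV (sets borel) (\<lambda>B. \<Sum>i\<in>UNIV. emeasure (jump_dist G i) B)"

definition mark_density :: "('w, 's::finite, 'd::finite, 'p) model \<Rightarrow> 's \<Rightarrow> real^'d \<Rightarrow> real" where
  "mark_density G i y = enn2real (RN_deriv (total_dist G) (jump_dist G i) y)"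

definition unnorm_flow ::
    "('w, 's::finite, 'd::finite, 'p) model \<Rightarrow> real \<Rightarrow> real^'s \<Rightarrow> real^'s" where
  "unnorm_flow G t p =
     p v* mat_exp (t *\<^sub>R (gen G - (\<chi> i j. if i = j then intensity G i else 0)))"

definition flow :: "('w, 's::finite, 'd::finite, 'p) model \<Rightarrow> real \<Rightarrow> real^'s \<Rightarrow> real^'s" where
  "flow G t p = (\<chi> i. unnorm_flow G t p $ i / (\<Sum>j\<in>UNIV. unnorm_flow G t p $ j))"

definition belief_update ::
    "('w, 's::finite, 'd::finite, 'p) model \<Rightarrow> real^'d \<Rightarrow> real^'s \<Rightarrow> real^'s" where
  "belief_update G y p =
     (\<chi> i. intensity G i * mark_density G i y * p $ i /
          (\<Sum>j\<in>UNIV. intensity G j * mark_density G j y * p $ j))"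

definition filter_dynamics ::
    "('w, 's::finite, 'd::finite, 'p) model \<Rightarrow> (real \<Rightarrow> real^'d) \<Rightarrow> (real \<Rightarrow> real^'s) \<Rightarrow> bool" where
  "filter_dynamics G x z \<longleftrightarrow>
     (\<forall>l t. jump_time x l \<le> t \<and> t < jump_time x (Suc l) \<longrightarrow>
        z t = flow G (t - jump_time x l) (z (jump_time x l))) \<and>
     (\<forall>l\<ge>1. z (jump_time x l) =
        belief_update G (jump x (jump_time x l)) (Lim (at_left (jump_time x l)) z))"

datatype 's source = Chain | Initial | Wait 's nat | Mark 's nat

primrec source_events :: "('w, 's::finite, 'd::finite, 'p) model \<Rightarrow> 's source \<Rightarrow> 'w set set" where
  "source_events G Chain = sigma_sets (space (base G))
     {chain G t -` A \<inter> space (base G) | t A. 0 \<le> t}"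
| "source_events G Initial = {obs0 G -` B \<inter> space (base G) | B. B \<in> sets borel}"
| "source_events G (Wait i n) = {wait G i n -` B \<inter> space (base G) | B. B \<in> sets borel}"
| "source_events G (Mark i n) = {mark G i n -` B \<inter> space (base G) | B. B \<in> sets borel}"

text \<open>In \<open>chain_markov\<close>, the Markov property with transition matrices \<open>mat_exp (t *\<^sub>R gen G)\<close> is
  written without dividing by the probability of the past. In \<open>belief_dynamics\<close>, the
  premise says that arrivals are visible as jumps of the observed path: if a mark can vanish, then
  \<open>obs\<close> does not reveal the arrivals, and the formula does not give the conditional
  probabilities given \<open>obs\<close>.\<close>

locale switching_model =
  fixes G :: "('w, 's::finite, 'd::finite, 'p::finite) model"
  assumes generator: "\<And>i j. i \<noteq> j \<Longrightarrow> 0 \<le> gen G $ i $ j" "\<And>i. (\<Sum>j\<in>UNIV. gen G $ i $ j) = 0"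
    and intensity_pos: "\<And>i. 0 < intensity G i"
    and jump_dist: "\<And>i. prob_space (jump_dist G i)" "\<And>i. sets (jump_dist G i) = sets borel"
    and discount_nonneg: "0 \<le> discount G"
    and switch_cost_triangle:
      "\<And>i a b c. switch_cost G i a c \<le> switch_cost G i a b + switch_cost G i b c"
    and switch_cost_lower: "\<exists>k0>0. \<forall>i a b. k0 < switch_cost G i a b"
    and law_prob: "\<And>p. p \<in> belief_simplex \<Longrightarrow> prob_space (law G p)"
    and law_sets: "\<And>p. p \<in> belief_simplex \<Longrightarrow> sets (law G p) = sets (base G)"
    and chain_measurable:
      "\<And>t. 0 \<le> t \<Longrightarrow> chain G t \<in> measurable (base G) (count_space UNIV)"
    and chain_right_continuous:
      "\<And>\<omega> t. \<lbrakk>\<omega> \<in> space (base G); 0 \<le> t\<rbrakk>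
         \<Longrightarrow> eventually (\<lambda>s. chain G s \<omega> = chain G t \<omega>) (at_right t)"
    and chain_left_limits:
      "\<And>\<omega> t. \<lbrakk>\<omega> \<in> space (base G); 0 < t\<rbrakk>
         \<Longrightarrow> \<exists>j. eventually (\<lambda>s. chain G s \<omega> = j) (at_left t)"
    and chain_initial:
      "\<And>p i. p \<in> belief_simplex
         \<Longrightarrow> measure (law G p) {\<omega> \<in> space (base G). chain G 0 \<omega> = i} = p $ i"
    and chain_markov:
      "\<And>p n (t :: nat \<Rightarrow> real) e.
         \<lbrakk>p \<in> belief_simplex; 0 \<le> t 0; \<And>k. k \<le> n \<Longrightarrow> t k \<le> t (Suc k)\<rbrakk> \<Longrightarrow>
         measure (law G p) {\<omega> \<in> space (base G). \<forall>k\<le>Suc n. chain G (t k) \<omega> = e k} =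
         measure (law G p) {\<omega> \<in> space (base G). \<forall>k\<le>n. chain G (t k) \<omega> = e k} *
           mat_exp ((t (Suc n) - t n) *\<^sub>R gen G) $ e n $ e (Suc n)"
    and obs0_measurable: "obs0 G \<in> borel_measurable (base G)"
    and obs0_law: "\<And>p. p \<in> belief_simplex \<Longrightarrow> distr (law G p) borel (obs0 G) = init_dist G"
    and wait_law:
      "\<And>p i n. p \<in> belief_simplex
         \<Longrightarrow> distributed (law G p) lborel (wait G i n) (exponential_density (intensity G i))"
    and mark_measurable: "\<And>i n. mark G i n \<in> borel_measurable (base G)"
    and mark_law:
      "\<And>p i n. p \<in> belief_simplex \<Longrightarrow> distr (law G p) borel (mark G i n) = jump_dist G i"
    and independent:
      "\<And>p. p \<in> belief_simplex \<Longrightarrow> prob_space.indep_sets (law G p) (source_events G) UNIV"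
    and belief_adapted:
      "\<And>p t. \<lbrakk>p \<in> belief_simplex; 0 \<le> t\<rbrakk>
         \<Longrightarrow> belief G p t \<in> borel_measurable (obs_filtration G p (ennreal t))"
    and belief_cond_prob:
      "\<And>p t i. \<lbrakk>p \<in> belief_simplex; 0 \<le> t\<rbrakk> \<Longrightarrow>
         AE \<omega> in cprob G p. belief G p t \<omega> $ i =
           real_cond_exp (cprob G p) (obs_filtration G p (ennreal t))
             (indicator {\<omega> \<in> space (base G). chain G t \<omega> = i}) \<omega>"
    and belief_right_continuous:
      "\<And>p. p \<in> belief_simplex \<Longrightarrow>
         AE \<omega> in cprob G p. \<forall>t\<ge>0. ((\<lambda>s. belief G p s \<omega>) \<longlongrightarrow> belief G p t \<omega>) (at_right t)"
    and belief_dynamics: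
      "\<And>p. \<lbrakk>p \<in> belief_simplex; \<And>i. emeasure (jump_dist G i) {0} = 0\<rbrakk> \<Longrightarrow>
         AE \<omega> in cprob G p. filter_dynamics G (\<lambda>t. obs G t \<omega>) (\<lambda>t. belief G p t \<omega>)"

definition mean_switch_cost ::
    "('w, 's::finite, 'd::finite, 'p) model \<Rightarrow> 'p \<Rightarrow> 'p \<Rightarrow> real^'s \<Rightarrow> real" where
  "mean_switch_cost G a b p = (\<Sum>i\<in>UNIV. switch_cost G i a b * p $ i)"

text \<open>A strategy consists of the switching times \<open>\<tau>\<close> and the chosen policies \<open>\<xi>\<close>;
  \<open>\<tau> k \<omega> = \<infinity>\<close> means that there are fewer than \<open>k\<close> switches.\<close>

type_synonym ('w, 'p) strategy = "(nat \<Rightarrow> 'w \<Rightarrow> ennreal) \<times> (nat \<Rightarrow> 'w \<Rightarrow> 'p)"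

definition admissible ::
    "('w, 's::finite, 'd::finite, 'p) model \<Rightarrow> real \<Rightarrow> real^'s \<Rightarrow> 'p \<Rightarrow> ('w, 'p) strategy set" where
  "admissible G T p a = {(\<tau>, \<xi>).
     (\<forall>\<omega>\<in>space (base G). \<tau> 0 \<omega> = 0 \<and> \<xi> 0 \<omega> = a \<and>
        (\<forall>k. (\<tau> k \<omega> \<le> ennreal T \<or> \<tau> k \<omega> = \<infinity>) \<and>
             (if \<tau> k \<omega> < \<infinity> then \<tau> k \<omega> < \<tau> (Suc k) \<omega> else \<tau> (Suc k) \<omega> = \<infinity>))) \<and>
     (\<forall>k. stopping_time (obs_filtration G p) (\<tau> k)) \<and>
     (\<forall>k. \<xi> k \<in> measurable
        (filtration.pre_sigma (space (base G)) (obs_filtration G p) (\<tau> k)) (count_space UNIV)) \<and>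
     (AE \<omega> in cprob G p. \<exists>k. \<tau> k \<omega> = \<infinity>) \<and>
     (\<integral>\<^sup>+\<omega>. (\<Sum>k. if \<tau> (Suc k) \<omega> < \<infinity>
        then ennreal (exp (- discount G * enn2real (\<tau> (Suc k) \<omega>)) *
          mean_switch_cost G (\<xi> k \<omega>) (\<xi> (Suc k) \<omega>) (belief G p (enn2real (\<tau> (Suc k) \<omega>)) \<omega>))
        else 0) \<partial>cprob G p) < \<infinity>}"

definition policy_at :: "('w, 'p) strategy \<Rightarrow> real \<Rightarrow> 'w \<Rightarrow> 'p" where
  "policy_at s t \<omega> =
     snd s (THE k. fst s k \<omega> \<le> ennreal t \<and> ennreal t < fst s (Suc k) \<omega>) \<omega>"

definition performance ::
    "('w, 's::finite, 'd::finite, 'p) model \<Rightarrow> real \<Rightarrow> real^'s \<Rightarrow> ('w, 'p) strategy \<Rightarrow> real" where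
  "performance G T p s = (\<integral>\<omega>.
     (LINT t:{0..T}|lborel. exp (- discount G * t) *
        (\<Sum>i\<in>UNIV. benefit G i (policy_at s t \<omega>) * (if chain G t \<omega> = i then 1 else 0)))
     - (\<Sum>k. if fst s (Suc k) \<omega> < \<infinity>
          then exp (- discount G * enn2real (fst s (Suc k) \<omega>)) *
            (\<Sum>i\<in>UNIV. switch_cost G i (snd s k \<omega>) (snd s (Suc k) \<omega>) *
               (if chain G (enn2real (fst s (Suc k) \<omega>)) \<omega> = i then 1 else 0))
          else 0)
     \<partial>cprob G p)"

definition value_fn ::
    "('w, 's::finite, 'd::finite, 'p) model \<Rightarrow> real \<Rightarrow> real^'s \<Rightarrow> 'p \<Rightarrow> real" where
  "value_fn G T p a = (SUP s\<in>admissible G T p a. performance G T p s)"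

end

theory Submission
  imports Defs
begin

text \<open>Let \<open>p = u x + v y\<close> with \<open>u, v > 0\<close>. On the \<open>\<sigma>\<close>-algebra generated by the chain and the
  compound Poisson data, the law with prior \<open>p\<close> is the mixture of the laws with priors \<open>x\<close> and \<open>y\<close>,
  because the prior enters only through the law of the chain, linearly. Hence observable \<open>p\<close>-null sets
  are null for \<open>x\<close> and \<open>y\<close>, so a strategy adapted to the \<open>p\<close>-augmented filtration is adapted to the
  other two. Its performance, written with the hidden chain instead of the belief process, is an
  expectation of one and the same random variable and therefore the mixture of its performances
  under \<open>x\<close> and \<open>y\<close>. Each of these is at most the value there; now take the supremum.\<close>

section \<open>Mixtures of two measures\<close>

text \<open>The model constrains the laws only through its sources, so the mixture identity cannot
  be expected on all of \<open>base G\<close>. Every integrand is therefore shown measurable for the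
  source events together with the observable null sets of the mixed prior; adding all null sets of
  \<open>base G\<close> could add sets that are not null for \<open>x\<close> or \<open>y\<close>.
  Admissibility is the second obstacle. Its cost condition evaluates \<open>belief G p\<close> at
  the switching times, and the belief process changes with the prior, so the condition is not about
  one random variable and the mixture formula cannot carry it over. It is replaced by finiteness of
  the expected number of switches, which mentions no belief. The equivalence holds because
  discounted costs are bounded above and away from 0 on a bounded horizon; it asks of the belief
  process that its paths stay in the simplex almost surely. Finally, \<open>value_fn\<close> is a
  supremum of reals, so the performances must form a nonempty set that is bounded above.\<close>

locale measure_mixture =
  fixes H M M1 M2 :: "'w measure" and u v :: real
  assumes subalg: "subalgebra M H" "subalgebra M1 H" "subalgebra M2 H"
    and weights: "0 < u" "0 < v"
    and emeasure_mix:
      "\<And>A. A \<in> sets H \<Longrightarrow>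
         emeasure M A = ennreal u * emeasure M1 A + ennreal v * emeasure M2 A"
begin

text \<open>The transfer lemmas below speak of \<open>M1\<close>; this symmetry carries them over to
  \<open>M2\<close>.\<close>

lemma swap: "measure_mixture H M M2 M1 v u"
  using subalg weights emeasure_mix by unfold_locales (auto simp: add.commute)

lemma nn_integral_mix:
  fixes f :: "'w \<Rightarrow> ennreal"
  assumes "f \<in> borel_measurable H"
  shows "(\<integral>\<^sup>+x. f x \<partial>M) = ennreal u * (\<integral>\<^sup>+x. f x \<partial>M1) + ennreal v * (\<integral>\<^sup>+x. f x \<partial>M2)"
  using assms
proof (induct rule: borel_measurable_induct)
  case (cong f g)
  have "space M = space H" "space M1 = space H" "space M2 = space H"
    using subalg by (auto simp: subalgebra_def)
  with cong(3) have "integral\<^sup>N M f = integral\<^sup>N M g" "integral\<^sup>N M1 f = integral\<^sup>N M1 g"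
      "integral\<^sup>N M2 f = integral\<^sup>N M2 g"
    by (auto intro!: nn_integral_cong)
  with cong(4) show ?case by simp
next
  case (set A)
  then have "A \<in> sets M" "A \<in> sets M1" "A \<in> sets M2"
    using subalg by (auto simp: subalgebra_def)
  with emeasure_mix[OF set] show ?case by simp
next
  case (mult f c)
  note [measurable] = mult(2)[THEN measurable_from_subalg[OF subalg(1)]]
    mult(2)[THEN measurable_from_subalg[OF subalg(2)]]
    mult(2)[THEN measurable_from_subalg[OF subalg(3)]]
  show ?case
    by (simp add: nn_integral_cmult mult(4) distrib_left mult_ac)
next
  case (add f g)
  note [measurable] = add(1,4)[THEN measurable_from_subalg[OF subalg(1)]]
    add(1,4)[THEN measurable_from_subalg[OF subalg(2)]]
    add(1,4)[THEN measurable_from_subalg[OF subalg(3)]]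
  show ?case
    by (simp add: nn_integral_add add(3,7) distrib_left add_ac)
next
  case (seq U)
  note [measurable] = seq(1)[THEN measurable_from_subalg[OF subalg(1)]]
    seq(1)[THEN measurable_from_subalg[OF subalg(2)]]
    seq(1)[THEN measurable_from_subalg[OF subalg(3)]]
  have sup: "integral\<^sup>N L (SUP i. U i) = (SUP i. integral\<^sup>N L (U i))"
    if "\<And>i. U i \<in> borel_measurable L" for L :: "'w measure"
    using nn_integral_monotone_convergence_SUP[OF seq(4), of L] that
    by (simp add: SUP_apply[abs_def] image_comp)
  have inc: "incseq (\<lambda>i. integral\<^sup>N L (U i))" for L :: "'w measure"
    using seq(4) by (auto simp: incseq_def le_fun_def intro!: nn_integral_mono)
  have "(SUP i. integral\<^sup>N M (U i)) =
      (SUP i. ennreal u * integral\<^sup>N M1 (U i) + ennreal v * integral\<^sup>N M2 (U i))"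
    by (simp add: seq(3))
  also have "\<dots> = (SUP i. ennreal u * integral\<^sup>N M1 (U i)) + (SUP i. ennreal v * integral\<^sup>N M2 (U i))"
    using inc by (intro ennreal_SUP_add) (auto simp: incseq_def intro!: mult_left_mono)
  finally have sum: "(SUP i. integral\<^sup>N M (U i)) =
      ennreal u * (SUP i. integral\<^sup>N M1 (U i)) + ennreal v * (SUP i. integral\<^sup>N M2 (U i))"
    by (simp only: SUP_mult_left_ennreal)
  have "integral\<^sup>N M (SUP i. U i) = (SUP i. integral\<^sup>N M (U i))"
    "integral\<^sup>N M1 (SUP i. U i) = (SUP i. integral\<^sup>N M1 (U i))"
    "integral\<^sup>N M2 (SUP i. U i) = (SUP i. integral\<^sup>N M2 (U i))"
    by (rule sup, measurable)+
  with sum show ?case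
    by (simp only:)
qed

text \<open>Here \<open>u > 0\<close> is essential: a set that is null for the mixture must be null
  for each component of positive weight.\<close>

lemma AE_mix:
  assumes "AE x in M. P x" and "Measurable.pred H P"
  shows "AE x in M1. P x"
proof -
  let ?N = "{x \<in> space H. \<not> P x}"
  have N: "?N \<in> sets H" using assms(2) by measurable
  have sp: "space M = space H" "space M1 = space H"
    and N': "?N \<in> sets M" "?N \<in> sets M1"
    using subalg N by (auto simp: subalgebra_def)
  have "emeasure M ?N = 0"
    using assms(1) N' by (simp add: AE_iff_measurable[OF N'(1)] sp)
  then have "ennreal u * emeasure M1 ?N = 0"
    using emeasure_mix[OF N] by simp
  then have "emeasure M1 ?N = 0"
    using weights by simp
  then show ?thesis
    using AE_iff_measurable[OF N'(2)] by (simp add: sp)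
qed

lemma nn_integral_finite_mix:
  fixes f :: "'w \<Rightarrow> ennreal"
  assumes "f \<in> borel_measurable H" and "(\<integral>\<^sup>+x. f x \<partial>M) < \<infinity>"
  shows "(\<integral>\<^sup>+x. f x \<partial>M1) < \<infinity>"
proof (rule ccontr)
  assume "\<not> ?thesis"
  then have "(\<integral>\<^sup>+x. f x \<partial>M1) = \<infinity>" by (simp add: less_top[symmetric])
  with nn_integral_mix[OF assms(1)] weights have "(\<integral>\<^sup>+x. f x \<partial>M) = \<infinity>"
    by (simp add: ennreal_mult_eq_top_iff ennreal_mult_top)
  with assms(2) show False by simp
qed

lemma integrable_mix:
  fixes f :: "'w \<Rightarrow> real"
  assumes f: "f \<in> borel_measurable H" and "integrable M f"
  shows "integrable M1 f"
proof -
  have [measurable]: "f \<in> borel_measurable M1"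
    using measurable_from_subalg[OF subalg(2) f] .
  have "(\<integral>\<^sup>+x. ennreal (norm (f x)) \<partial>M1) < \<infinity>"
    using assms by (intro nn_integral_finite_mix) (auto simp: integrable_iff_bounded)
  then show ?thesis by (simp add: integrable_iff_bounded)
qed

lemma integral_mix:
  fixes f :: "'w \<Rightarrow> real"
  assumes f[measurable]: "f \<in> borel_measurable H" and int: "integrable M f"
  shows "(\<integral>x. f x \<partial>M) = u * (\<integral>x. f x \<partial>M1) + v * (\<integral>x. f x \<partial>M2)"
proof -
  interpret s: measure_mixture H M M2 M1 v u by (rule swap)
  have i: "integrable M1 f" "integrable M2 f"
    using integrable_mix[OF assms] s.integrable_mix[OF assms] .
  \<comment> \<open>\<open>enn2real\<close> sends \<infinity> to 0 and is additive only on finite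
    values, so finiteness under both components is established first. It is then applied to
    \<open>f\<close> and to \<open>- f\<close>, the two parts of the Bochner integral.\<close>
  have part: "enn2real (\<integral>\<^sup>+x. ennreal (g x) \<partial>M) =
      u * enn2real (\<integral>\<^sup>+x. ennreal (g x) \<partial>M1) + v * enn2real (\<integral>\<^sup>+x. ennreal (g x) \<partial>M2)"
    if [measurable]: "g \<in> borel_measurable H" and "integrable M g" for g :: "'w \<Rightarrow> real"
  proof -
    have i: "integrable M1 g" "integrable M2 g"
      using integrable_mix[OF that] s.integrable_mix[OF that] .
    have "(\<integral>\<^sup>+x. ennreal (g x) \<partial>M1) < \<infinity>" "(\<integral>\<^sup>+x. ennreal (g x) \<partial>M2) < \<infinity>"
      using i by (simp_all add: real_integrable_def less_top)
    then show ?thesis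
      using weights by (simp add: nn_integral_mix enn2real_plus ennreal_mult_less_top enn2real_mult)
  qed
  show ?thesis
    using part[of f] part[of "\<lambda>x. - f x"] int i
    by (simp add: real_lebesgue_integral_def algebra_simps)
qed

end

text \<open>Dynkin's theorem: the sets satisfying the identity form a Dynkin system. Complements are
  where total mass one and \<open>u + v = 1\<close> enter; \<open>measure\<close> is used rather
  than \<open>emeasure\<close> so that they become real subtraction.\<close>

lemma measure_mixture_sigma_sets:
  assumes "prob_space M" "prob_space M1" "prob_space M2"
    and sp: "space M = \<Omega>" "space M1 = \<Omega>" "space M2 = \<Omega>"
    and E: "Int_stable E" "E \<subseteq> sets M" "E \<subseteq> sets M1" "E \<subseteq> sets M2"
    and w: "u + v = (1::real)"
    and mix: "\<And>A. A \<in> E \<Longrightarrow> measure M A = u * measure M1 A + v * measure M2 A"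
    and A: "A \<in> sigma_sets \<Omega> E"
  shows "measure M A = u * measure M1 A + v * measure M2 A"
proof -
  interpret M: prob_space M by fact
  interpret M1: prob_space M1 by fact
  interpret M2: prob_space M2 by fact
  have sub: "sigma_sets \<Omega> E \<subseteq> sets M" "sigma_sets \<Omega> E \<subseteq> sets M1" "sigma_sets \<Omega> E \<subseteq> sets M2"
    using sets.sigma_sets_subset[OF E(2)] sets.sigma_sets_subset[OF E(3)]
      sets.sigma_sets_subset[OF E(4)] sp by simp_all
  have "E \<subseteq> Pow \<Omega>" using E(2) sets.space_closed[of M] sp by blast
  with E(1) show ?thesis using A
  proof (induct rule: sigma_sets_induct_disjoint)
    case (basic A)
    then show ?case by (rule mix)
  next
    case (compl A)
    then have "A \<in> sets M" "A \<in> sets M1" "A \<in> sets M2" using sub by auto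
    then have "measure M (\<Omega> - A) = 1 - measure M A" "measure M1 (\<Omega> - A) = 1 - measure M1 A"
        "measure M2 (\<Omega> - A) = 1 - measure M2 A"
      using M.prob_compl M1.prob_compl M2.prob_compl sp by auto
    moreover have "u * (1 - a) + v * (1 - b) = 1 - (u * a + v * b)" for a b
      using w by (simp add: right_diff_distrib)
    ultimately show ?case using compl(2) by metis
  next
    case (union A)
    then have r: "range A \<subseteq> sets M" "range A \<subseteq> sets M1" "range A \<subseteq> sets M2" using sub by auto
    have "(\<lambda>i. u * measure M1 (A i) + v * measure M2 (A i)) sums
        (u * measure M1 (\<Union>i. A i) + v * measure M2 (\<Union>i. A i))"
      using M1.finite_measure_UNION[OF r(2) union(1)] M2.finite_measure_UNION[OF r(3) union(1)]
      by (intro sums_add sums_mult)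
    moreover have "(\<lambda>i. measure M (A i)) sums measure M (\<Union>i. A i)"
      by (rule M.finite_measure_UNION[OF r(1) union(1)])
    ultimately show ?case
      using union(3) sums_unique2 by simp
  qed simp
qed

text \<open>The sorted enumeration of \<open>J\<close>, continued constantly after its last element,
  so that it is monotone on all naturals as \<open>cylinder_prob\<close> demands.\<close>

lemma finite_set_eq_mono_image:
  fixes J :: "'a::linorder set"
  assumes "finite J" "J \<noteq> {}"
  obtains t n where "mono t" "J = t ` {..n::nat}"
proof
  let ?xs = "sorted_list_of_set J" and ?n = "card J - 1"
  let ?t = "\<lambda>k. ?xs ! min k ?n"
  have len: "length ?xs = card J" "card J > 0" using assms by (auto simp: card_gt_0_iff)
  show "mono ?t"
    using len by (intro monoI sorted_nth_mono) auto
  have "J = set ?xs" using assms by simp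
  also have "\<dots> = ?t ` {..?n}"
    using len by (auto simp: set_conv_nth image_iff)
  finally show "J = ?t ` {..?n}" .
qed

section \<open>The law is affine in the initial distribution\<close>

text \<open>The events on which laws with different priors are comparable: the assumptions determine
  each law here and leave it open elsewhere in \<open>base G\<close>.\<close>

definition source_algebra :: "('w, 's::finite, 'd::finite, 'p) model \<Rightarrow> 'w measure" where
  "source_algebra G = sigma (space (base G)) (\<Union>j. source_events G j)"

lemma source_events_subset: "source_events G j \<subseteq> Pow (space (base G))"
proof (cases j)
  case Chain
  have "A \<subseteq> space (base G)" if "A \<in> source_events G Chain" for A
    using that unfolding source_events.simps by (rule sigma_sets_into_sp[rotated]) auto
  with Chain show ?thesis by blast
qed auto

lemma space_in_source_events: "space (base G) \<in> source_events G j"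
proof (cases j)
  case Chain
  show ?thesis unfolding Chain source_events.simps by (rule sigma_sets_top)
next
  case Initial
  show ?thesis unfolding Initial source_events.simps
    by (rule CollectI, rule exI[of _ UNIV]) simp
next
  case (Wait i n)
  show ?thesis unfolding Wait source_events.simps
    by (rule CollectI, rule exI[of _ UNIV]) simp
next
  case (Mark i n)
  show ?thesis unfolding Mark source_events.simps
    by (rule CollectI, rule exI[of _ UNIV]) simp
qed

lemma source_events_Int:
  assumes "A \<in> source_events G j" "B' \<in> source_events G j"
  shows "A \<inter> B' \<in> source_events G j"
proof (cases j)
  case Chain
  have "{chain G t -` A \<inter> space (base G) | t A. 0 \<le> t} \<subseteq> Pow (space (base G))"
    by auto
  then interpret sigma_algebra "space (base G)" "source_events G Chain"
    unfolding source_events.simps by (rule sigma_algebra_sigma_sets)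
  show ?thesis using assms unfolding Chain by (rule Int)
next
  case Initial
  with assms obtain B C where "A = obs0 G -` B \<inter> space (base G)" "B' = obs0 G -` C \<inter> space (base G)"
    "B \<in> sets borel" "C \<in> sets borel" by auto
  then show ?thesis unfolding Initial source_events.simps
    by (intro CollectI exI[of _ "B \<inter> C"]) auto
next
  case (Wait i n)
  with assms obtain B C where "A = wait G i n -` B \<inter> space (base G)"
    "B' = wait G i n -` C \<inter> space (base G)" "B \<in> sets borel" "C \<in> sets borel" by auto
  then show ?thesis unfolding Wait source_events.simps
    by (intro CollectI exI[of _ "B \<inter> C"]) auto
next
  case (Mark i n)
  with assms obtain B C where "A = mark G i n -` B \<inter> space (base G)"
    "B' = mark G i n -` C \<inter> space (base G)" "B \<in> sets borel" "C \<in> sets borel" by auto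
  then show ?thesis unfolding Mark source_events.simps
    by (intro CollectI exI[of _ "B \<inter> C"]) auto
qed

lemma sets_source_algebra:
  "sets (source_algebra G) = sigma_sets (space (base G)) (\<Union>j. source_events G j)"
  unfolding source_algebra_def
  by (rule sets_measure_of) (rule UN_least, rule source_events_subset)

lemma space_source_algebra[simp]: "space (source_algebra G) = space (base G)"
  unfolding source_algebra_def
  by (rule space_measure_of) (rule UN_least, rule source_events_subset)

section \<open>Markov cylinders and the joint law of the sources\<close>

context switching_model
begin

lemma space_law: "p \<in> belief_simplex \<Longrightarrow> space (law G p) = space (base G)"
  by (rule sets_eq_imp_space_eq[OF law_sets])

text \<open>\<open>indep_sets\<close> includes the demand that its families consist of events, which
  gives measurability of all sources at once.\<close>

lemma source_events_law:
  assumes "p \<in> belief_simplex"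
  shows "source_events G j \<subseteq> sets (law G p)"
  using independent[OF assms] unfolding prob_space.indep_sets_def[OF law_prob[OF assms]] by blast

lemma source_algebra_subset_law:
  assumes "p \<in> belief_simplex"
  shows "sets (source_algebra G) \<subseteq> sets (law G p)"
proof -
  have "(\<Union>j. source_events G j) \<subseteq> sets (law G p)"
    using source_events_law[OF assms] by (rule UN_least)
  from sets.sigma_sets_subset[OF this] show ?thesis
    by (simp only: sets_source_algebra space_law[OF assms])
qed

text \<open>Iterated Markov property. The prior survives only in the factor \<open>p $ e 0\<close>,
  so the formula is linear in \<open>p\<close>; this is the origin of the affine dependence. The
  cylinder has to start at time 0 for that factor to appear.\<close>

lemma cylinder_prob:
  assumes p: "p \<in> belief_simplex" and "t 0 = 0" "mono t"
  shows "measure (law G p) {\<omega> \<in> space (base G). \<forall>k\<le>n. chain G (t k) \<omega> = e k} =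
    p $ e 0 * (\<Prod>k<n. mat_exp ((t (Suc k) - t k) *\<^sub>R gen G) $ e k $ e (Suc k))"
proof (induction n)
  case 0
  then show ?case using chain_initial[OF p] assms by simp
next
  case (Suc n)
  have "measure (law G p) {\<omega> \<in> space (base G). \<forall>k\<le>Suc n. chain G (t k) \<omega> = e k} =
      measure (law G p) {\<omega> \<in> space (base G). \<forall>k\<le>n. chain G (t k) \<omega> = e k} *
        mat_exp ((t (Suc n) - t n) *\<^sub>R gen G) $ e n $ e (Suc n)"
    using assms by (intro chain_markov[OF p]) (auto intro: monoD)
  also note Suc
  finally show ?case by (simp only: prod.lessThan_Suc mult.assoc)
qed

text \<open>Time 0 belongs to every index set so that \<open>cylinder_prob\<close> applies. The
  empty set is added because two cylinders with conflicting states are disjoint.\<close>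

definition chain_cylinders :: "'w set set" where
  "chain_cylinders = insert {} {{\<omega> \<in> space (base G). \<forall>t\<in>J. chain G t \<omega> = e t} | J e.
     finite J \<and> 0 \<in> J \<and> J \<subseteq> {0..}}"

lemma chain_cylindersI:
  assumes "finite J" "0 \<in> J" "J \<subseteq> {0..}"
  shows "{\<omega> \<in> space (base G). \<forall>t\<in>J. chain G t \<omega> = e t} \<in> chain_cylinders"
  using assms unfolding chain_cylinders_def by blast

lemma Int_stable_chain_cylinders: "Int_stable chain_cylinders"
proof (rule Int_stableI)
  fix A B assume A: "A \<in> chain_cylinders" and B: "B \<in> chain_cylinders"
  show "A \<inter> B \<in> chain_cylinders"
  proof (cases "A \<inter> B = {}")
    case True
    then show ?thesis by (simp add: chain_cylinders_def)
  next
    case False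
    with A B obtain J e J' e' where A_eq: "A = {\<omega> \<in> space (base G). \<forall>t\<in>J. chain G t \<omega> = e t}"
      and B_eq: "B = {\<omega> \<in> space (base G). \<forall>t\<in>J'. chain G t \<omega> = e' t}"
      and J: "finite J" "0 \<in> J" "J \<subseteq> {0..}" "finite J'" "0 \<in> J'" "J' \<subseteq> {0..}"
      unfolding chain_cylinders_def by blast
    \<comment> \<open>A common point shows that the two state assignments agree where both apply;
      its own path serves as the joint assignment on \<open>J \<union> J'\<close>.\<close>
    from False obtain \<omega> where "\<omega> \<in> A \<inter> B" by blast
    then have "A \<inter> B = {\<omega>' \<in> space (base G). \<forall>t\<in>J \<union> J'. chain G t \<omega>' = chain G t \<omega>}"
      by (auto simp: A_eq B_eq)
    moreover have "finite (J \<union> J')" "0 \<in> J \<union> J'" "J \<union> J' \<subseteq> {0..}"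
      using J by auto
    ultimately show ?thesis by (simp only: chain_cylindersI)
  qed
qed

lemma chain_events_cylinders:
  "source_events G Chain \<subseteq> sigma_sets (space (base G)) chain_cylinders"
proof -
  have sub: "chain_cylinders \<subseteq> Pow (space (base G))"
    by (auto simp: chain_cylinders_def)
  interpret sigma_algebra "space (base G)" "sigma_sets (space (base G)) chain_cylinders"
    using sub by (rule sigma_algebra_sigma_sets)
  have "chain G t -` A \<inter> space (base G) \<in> sigma_sets (space (base G)) chain_cylinders"
    if t: "0 \<le> t" for t A
  proof -
    \<comment> \<open>An event at the single time \<open>t\<close> is split according to the pair of
      states at times 0 and \<open>t\<close>, since cylinders must contain 0. Finiteness of the
      state space makes this a finite union.\<close>
    define F where "F = {e \<in> {0, t} \<rightarrow>\<^sub>E UNIV. e t \<in> A}"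
    define cyl where "cyl e = {\<omega> \<in> space (base G). \<forall>s\<in>{0, t}. chain G s \<omega> = e s}" for e
    have "finite F"
      unfolding F_def by (rule finite_subset[OF _ finite_PiE[of "{0, t}" "\<lambda>_. UNIV"]]) auto
    moreover have "cyl e \<in> sigma_sets (space (base G)) chain_cylinders" for e
    proof (rule sigma_sets.Basic)
      have "finite {0, t}" "0 \<in> {0, t}" "{0, t} \<subseteq> {0..}" using t by auto
      then show "cyl e \<in> chain_cylinders"
        unfolding cyl_def by (rule chain_cylindersI)
    qed
    ultimately have "(\<Union>e\<in>F. cyl e) \<in> sigma_sets (space (base G)) chain_cylinders"
      by (intro finite_UN) auto
    moreover have "chain G t -` A \<inter> space (base G) = (\<Union>e\<in>F. cyl e)"
    proof (intro equalityI subsetI)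
      fix \<omega> assume \<omega>: "\<omega> \<in> chain G t -` A \<inter> space (base G)"
      have "(\<lambda>s\<in>{0, t}. chain G s \<omega>) \<in> F" "\<omega> \<in> cyl (\<lambda>s\<in>{0, t}. chain G s \<omega>)"
        using \<omega> by (simp_all add: F_def cyl_def)
      then show "\<omega> \<in> (\<Union>e\<in>F. cyl e)" by blast
    qed (auto simp: F_def cyl_def)
    ultimately show ?thesis by simp
  qed
  then show ?thesis
    unfolding source_events.simps by (intro sigma_sets_mono) blast
qed

lemma measure_vimage_eq:
  assumes "distr M N f = distr M' N f" "f \<in> measurable M N" "f \<in> measurable M' N" "B \<in> sets N"
  shows "measure M (f -` B \<inter> space M) = measure M' (f -` B \<inter> space M')"
  using measure_distr[OF assms(2,4)] measure_distr[OF assms(3,4)] assms(1) by simp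

lemma source_prob_initial_law_free:
  assumes "p \<in> belief_simplex" "q \<in> belief_simplex" "j \<noteq> Chain" "A \<in> source_events G j"
  shows "measure (law G p) A = measure (law G q) A"
proof -
  note sp = space_law[OF assms(1)] space_law[OF assms(2)]
  have meas: "f \<in> measurable (law G p) borel" "f \<in> measurable (law G q) borel"
    if "f \<in> borel_measurable (base G)" for f :: "'w \<Rightarrow> real^'d"
    using that measurable_cong_sets[OF law_sets[OF assms(1)] refl, of borel]
      measurable_cong_sets[OF law_sets[OF assms(2)] refl, of borel] by auto
  show ?thesis
  proof (cases j)
    case Initial
    with assms(4) obtain B where "A = obs0 G -` B \<inter> space (base G)" "B \<in> sets borel" by auto
    then show ?thesis
      using measure_vimage_eq[OF _ meas[OF obs0_measurable], of B] obs0_law assms(1,2) sp by simp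
  next
    case (Wait i n)
    with assms(4) obtain B where "A = wait G i n -` B \<inter> space (base G)" "B \<in> sets lborel" by auto
    moreover note d = wait_law[OF assms(1), of i n] wait_law[OF assms(2), of i n]
    ultimately show ?thesis
      using measure_vimage_eq[OF _ d[THEN distributed_measurable], of B]
        d[THEN distributed_distr_eq_density] sp by simp
  next
    case (Mark i n)
    with assms(4) obtain B where "A = mark G i n -` B \<inter> space (base G)" "B \<in> sets borel" by auto
    then show ?thesis
      using measure_vimage_eq[OF _ meas[OF mark_measurable], of i n B] mark_law assms(1,2) sp by simp
  qed (use assms in simp)
qed

text \<open>Two extensions by Dynkin's theorem: from cylinders to all chain events, then from finite
  intersections over sources to the whole source algebra. In the second one independence gives a
  product in which only the chain factor varies with the prior; with more than one varying factor
  the product would not be affine.\<close>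

lemma law_mixture:
  assumes x: "x \<in> belief_simplex" and y: "y \<in> belief_simplex"
    and w: "0 < u" "0 < v" "u + v = 1" and p: "u *\<^sub>R x + v *\<^sub>R y \<in> belief_simplex"
    and A: "A \<in> sets (source_algebra G)"
  shows "measure (law G (u *\<^sub>R x + v *\<^sub>R y)) A = u * measure (law G x) A + v * measure (law G y) A"
proof -
  let ?\<Omega> = "space (base G)" and ?p = "u *\<^sub>R x + v *\<^sub>R y"
  let ?mix = "\<lambda>A. measure (law G ?p) A = u * measure (law G x) A + v * measure (law G y) A"
  note probs = law_prob[OF p] law_prob[OF x] law_prob[OF y]
    space_law[OF p] space_law[OF x] space_law[OF y]
  have cyl: "?mix B" if "B \<in> chain_cylinders" for B
  proof (cases "B = {}")
    case False
    with that obtain J e where B: "B = {\<omega> \<in> ?\<Omega>. \<forall>t\<in>J. chain G t \<omega> = e t}"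
      and J: "finite J" "0 \<in> J" "J \<subseteq> {0..}"
      unfolding chain_cylinders_def by blast
    obtain t n where t: "mono t" "J = t ` {..n::nat}"
      using finite_set_eq_mono_image[OF J(1)] J(2) by blast
    \<comment> \<open>The least time is 0, because \<open>J\<close> contains 0 and no negative
      number.\<close>
    have "t 0 \<in> J" using t(2) by auto
    moreover obtain k where "t k = 0" using J(2) t(2) by force
    ultimately have "t 0 = 0" using J(3) monoD[OF t(1), of 0 k] by auto
    moreover have "B = {\<omega> \<in> ?\<Omega>. \<forall>k\<le>n. chain G (t k) \<omega> = e (t k)}"
      unfolding B t(2) by auto
    ultimately show ?thesis
      using t(1) by (simp add: cylinder_prob[where e="\<lambda>k. e (t k)"] x y p algebra_simps)
  qed simp
  have cyl_sets: "chain_cylinders \<subseteq> sets (law G q)" if q: "q \<in> belief_simplex" for q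
  proof -
    have "{\<omega> \<in> ?\<Omega>. \<forall>t\<in>J. chain G t \<omega> = e t} \<in> sets (law G q)"
      if "finite J" "0 \<in> J" "J \<subseteq> {0..}" for J e
    proof -
      have "chain G t \<in> measurable (base G) (count_space UNIV)" if "t \<in> J" for t
        using chain_measurable \<open>J \<subseteq> {0..}\<close> that by auto
      then have "{\<omega> \<in> ?\<Omega>. \<forall>t\<in>J. chain G t \<omega> = e t} \<in> sets (base G)"
        using \<open>finite J\<close> by (intro sets.sets_Collect_finite_All) auto
      then show ?thesis using law_sets[OF q] by simp
    qed
    then show ?thesis by (auto simp: chain_cylinders_def)
  qed
  have chain: "?mix B" if "B \<in> source_events G Chain" for B
  proof -
    have B: "B \<in> sigma_sets ?\<Omega> chain_cylinders"
      using chain_events_cylinders that by (rule subsetD)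
    show ?thesis
    using probs Int_stable_chain_cylinders cyl_sets[OF p] cyl_sets[OF x] cyl_sets[OF y] w(3) cyl
    by (rule measure_mixture_sigma_sets[where \<Omega> = ?\<Omega>, OF _ _ _ _ _ _ _ _ _ _ _ _ B])
  qed
  \<comment> \<open>Finite intersections are indexed by families over all sources that are trivial
    at all but finitely many, so that two of them intersect pointwise.\<close>
  let ?E = "{\<Inter>(range B) | B. (\<forall>j. B j \<in> source_events G j) \<and> finite {j. B j \<noteq> ?\<Omega>}}"
  have stable: "Int_stable ?E"
  proof (rule Int_stableI, safe)
    fix B C assume "\<forall>j. B j \<in> source_events G j" "finite {j. B j \<noteq> ?\<Omega>}"
      "\<forall>j. C j \<in> source_events G j" "finite {j. C j \<noteq> ?\<Omega>}"
    moreover have "{j. B j \<inter> C j \<noteq> ?\<Omega>} \<subseteq> {j. B j \<noteq> ?\<Omega>} \<union> {j. C j \<noteq> ?\<Omega>}" by auto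
    ultimately show "\<exists>D. \<Inter>(range B) \<inter> \<Inter>(range C) = \<Inter>(range D) \<and>
        (\<forall>j. D j \<in> source_events G j) \<and> finite {j. D j \<noteq> ?\<Omega>}"
      by (intro exI[of _ "\<lambda>j. B j \<inter> C j"])
        (auto intro: source_events_Int finite_subset)
  qed
  have E: "?mix (\<Inter>(range B)) \<and> (\<forall>q\<in>belief_simplex. \<Inter>(range B) \<in> sets (law G q))"
    if B: "\<And>j. B j \<in> source_events G j" "finite {j. B j \<noteq> ?\<Omega>}" for B
  proof -
    \<comment> \<open>Inserting \<open>Chain\<close> keeps the index set nonempty, as independence
      requires, and lets the chain factor always be split off, even when it is trivial.\<close>
    let ?J = "insert Chain {j. B j \<noteq> ?\<Omega>}"
    let ?c = "\<lambda>q. \<Prod>j\<in>?J - {Chain}. measure (law G q) (B j)"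
    have int: "\<Inter>(range B) = (\<Inter>j\<in>?J. B j)"
    proof -
      have "B j \<subseteq> ?\<Omega>" for j using B(1) source_events_subset by blast
      then show ?thesis by blast
    qed
    have eq: "measure (law G q) (\<Inter>(range B)) = measure (law G q) (B Chain) * ?c q"
      if q: "q \<in> belief_simplex" for q
    proof -
      have "measure (law G q) (\<Inter>j\<in>?J. B j) = (\<Prod>j\<in>?J. measure (law G q) (B j))"
        using independent[OF q] B
        by (intro prob_space.indep_setsD[OF law_prob[OF q], of "source_events G" UNIV]) auto
      also have "\<dots> = measure (law G q) (B Chain) * ?c q"
        using B(2) by (subst prod.remove[of _ Chain]) auto
      finally show ?thesis unfolding int .
    qed
    have "?c x = ?c ?p" "?c y = ?c ?p"
      using B(1) x y p by (auto intro!: prod.cong source_prob_initial_law_free)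
    then have "?mix (\<Inter>(range B))"
      using chain[OF B(1)] by (simp add: eq x y p algebra_simps)
    moreover have "\<Inter>(range B) \<in> sets (law G q)" if "q \<in> belief_simplex" for q
      unfolding int using B source_events_law[OF that] by (intro sets.finite_INT) auto
    ultimately show ?thesis by blast
  qed
  have E_sets: "?E \<subseteq> sets (law G q)" if "q \<in> belief_simplex" for q
    using E that by blast
  have "source_events G j \<subseteq> ?E" for j
  proof
    fix B assume B: "B \<in> source_events G j"
    let ?D = "\<lambda>i. if i = j then B else ?\<Omega>"
    have "B = \<Inter>(range ?D)"
      using B source_events_subset[of G j] by (auto split: if_splits)
    moreover have "finite {i. ?D i \<noteq> ?\<Omega>}"
      by (rule finite_subset[of _ "{j}"]) auto
    ultimately show "B \<in> ?E"
      using B space_in_source_events[of G] by (intro CollectI exI[of _ ?D]) auto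
  qed
  then have "sets (source_algebra G) \<subseteq> sigma_sets ?\<Omega> ?E"
    unfolding sets_source_algebra by (intro sigma_sets_mono) blast
  with A have "A \<in> sigma_sets ?\<Omega> ?E" by blast
  moreover have "?mix B" if "B \<in> ?E" for B using that E by blast
  ultimately show ?thesis
    using measure_mixture_sigma_sets[OF probs stable E_sets[OF p] E_sets[OF x] E_sets[OF y] w(3)]
    by blast
qed

end

section \<open>The observation filtration and the completed laws\<close>

text \<open>A countable set of times approaching every \<open>s \<ge> 0\<close> from the right. For
  \<open>k = \<lfloor>s * (n + 1)\<rfloor>\<close> the point lies strictly above \<open>s\<close>,
  as \<open>at_right\<close> requires, and at most \<open>1 / (n + 1)\<close> above it.\<close>

definition right_grid :: "nat \<Rightarrow> nat \<Rightarrow> real" where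
  "right_grid n k = (real k + 1) / (real n + 1)"

lemma right_grid_nonneg: "0 \<le> right_grid n k"
  by (simp add: right_grid_def)

lemma right_grid_tendsto:
  assumes "0 \<le> s"
  shows "filterlim (\<lambda>n. right_grid n (nat \<lfloor>s * (real n + 1)\<rfloor>)) (at_right s) sequentially"
proof -
  have gt: "s < right_grid n (nat \<lfloor>s * (real n + 1)\<rfloor>)" for n
    using assms unfolding right_grid_def by (simp add: pos_less_divide_eq)
  have le: "right_grid n (nat \<lfloor>s * (real n + 1)\<rfloor>) \<le> s + 1 / (real n + 1)" for n
  proof -
    have "real (nat \<lfloor>s * (real n + 1)\<rfloor>) + 1 \<le> s * (real n + 1) + 1"
      using assms by simp
    then have "right_grid n (nat \<lfloor>s * (real n + 1)\<rfloor>) \<le> (s * (real n + 1) + 1) / (real n + 1)"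
      unfolding right_grid_def by (intro divide_right_mono) auto
    then show ?thesis by (simp add: add_divide_distrib)
  qed
  have "(\<lambda>n. s + 1 / (real n + 1)) \<longlonglongrightarrow> s"
    using tendsto_add[OF tendsto_const LIMSEQ_Suc[OF lim_inverse_n'], of s] by (simp add: add.commute)
  then have "(\<lambda>n. right_grid n (nat \<lfloor>s * (real n + 1)\<rfloor>)) \<longlonglongrightarrow> s"
    by (rule tendsto_sandwich[rotated 3, OF _ always_eventually always_eventually tendsto_const])
      (use gt le in \<open>auto intro: less_imp_le\<close>)
  moreover have "right_grid n (nat \<lfloor>s * (real n + 1)\<rfloor>) \<noteq> s" for n
    using gt[of n] by simp
  ultimately show ?thesis
    using gt by (auto simp: filterlim_at intro!: always_eventually)
qed

text \<open>Needed for \<open>obs\<close>, whose index set is random and infinite when arrivals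
  accumulate. In that case the sum is 0 by convention; otherwise the partial sums are eventually
  constant and the sum is their limit.\<close>

lemma borel_measurable_sum_random_set:
  fixes f :: "nat \<Rightarrow> 'a \<Rightarrow> 'b::{banach, second_countable_topology}"
  assumes [measurable]: "\<And>n. Measurable.pred M (P n)" "\<And>n. f n \<in> borel_measurable M"
  shows "(\<lambda>x. \<Sum>n | P n x. f n x) \<in> borel_measurable M"
proof -
  have eq: "(\<Sum>n | P n x. f n x) = (if \<exists>N. \<forall>n\<ge>N. \<not> P n x
      then lim (\<lambda>N. \<Sum>n<N. if P n x then f n x else 0) else 0)" for x
  proof (cases "\<exists>N. \<forall>n\<ge>N. \<not> P n x")
    case True
    then obtain N where N: "\<And>n. n \<ge> N \<Longrightarrow> \<not> P n x" by blast
    have "(\<Sum>n<K. if P n x then f n x else 0) = (\<Sum>n | P n x. f n x)" if "K \<ge> N" for K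
    proof -
      have "n < K" if "P n x" for n
        using N[of n] that \<open>K \<ge> N\<close> by (metis not_less order_trans)
      then have eq: "{n. P n x} = {n \<in> {..<K}. P n x}" by auto
      show ?thesis unfolding eq by (rule sum.inter_filter[symmetric]) simp
    qed
    then have "(\<lambda>K. \<Sum>n<K. if P n x then f n x else 0) \<longlonglongrightarrow> (\<Sum>n | P n x. f n x)"
      by (intro tendsto_eventually) (auto simp: eventually_sequentially)
    with True show ?thesis by (simp add: limI)
  next
    case False
    then have "infinite {n. P n x}"
      by (auto simp: infinite_nat_iff_unbounded_le)
    then show ?thesis unfolding if_not_P[OF False] by (rule sum.infinite)
  qed
  show ?thesis unfolding eq by measurable
qed

lemma closed_belief_simplex: "closed (belief_simplex :: (real^'s::finite) set)"
proof -
  have eq: "belief_simplex = {p::real^'s. (\<forall>i. 0 \<le> p $ i \<and> p $ i \<le> 1) \<and> (\<Sum>i\<in>UNIV. p $ i) = 1}"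
    by (auto simp: belief_simplex_def)
  show ?thesis
    unfolding eq by (intro closed_Collect_conj closed_Collect_all closed_Collect_le
        closed_Collect_eq continuous_intros)
qed

lemma convex_belief_simplex: "convex (belief_simplex :: (real^'s::finite) set)"
proof (rule convexI)
  fix x y :: "real^'s" and u v :: real
  assume x: "x \<in> belief_simplex" and y: "y \<in> belief_simplex" and w: "0 \<le> u" "0 \<le> v" "u + v = 1"
  have "(u *\<^sub>R x + v *\<^sub>R y) $ i \<in> {0..1}" for i
  proof -
    have i: "0 \<le> x $ i" "x $ i \<le> 1" "0 \<le> y $ i" "y $ i \<le> 1"
      using x y by (auto simp: belief_simplex_def)
    have "u * x $ i + v * y $ i \<le> u * 1 + v * 1"
      using i w by (intro add_mono mult_left_mono)
    with i w show ?thesis by simp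
  qed
  moreover have "(\<Sum>i\<in>UNIV. (u *\<^sub>R x + v *\<^sub>R y) $ i) = u * (\<Sum>i\<in>UNIV. x $ i) + v * (\<Sum>i\<in>UNIV. y $ i)"
    by (simp add: sum.distrib sum_distrib_left)
  ultimately show "u *\<^sub>R x + v *\<^sub>R y \<in> belief_simplex"
    using x y w by (auto simp: belief_simplex_def)
qed

section \<open>Observations as functions of the sources\<close>

context switching_model
begin

lemma source_event_sets: "A \<in> source_events G j \<Longrightarrow> A \<in> sets (source_algebra G)"
  unfolding sets_source_algebra by (rule sigma_sets.Basic) (rule UN_I[OF UNIV_I])

lemma wait_source[measurable]: "wait G i n \<in> borel_measurable (source_algebra G)"
proof (rule measurableI)
  fix B :: "real set" assume "B \<in> sets borel"
  then have "wait G i n -` B \<inter> space (base G) \<in> source_events G (Wait i n)"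
    unfolding source_events.simps by blast
  from source_event_sets[OF this] show "wait G i n -` B \<inter> space (source_algebra G) \<in> sets (source_algebra G)"
    by simp
qed simp

lemma mark_source[measurable]: "mark G i n \<in> borel_measurable (source_algebra G)"
proof (rule measurableI)
  fix B :: "(real^'d) set" assume "B \<in> sets borel"
  then have "mark G i n -` B \<inter> space (base G) \<in> source_events G (Mark i n)"
    unfolding source_events.simps by blast
  from source_event_sets[OF this] show "mark G i n -` B \<inter> space (source_algebra G) \<in> sets (source_algebra G)"
    by simp
qed simp

lemma obs0_source[measurable]: "obs0 G \<in> borel_measurable (source_algebra G)"
proof (rule measurableI)
  fix B :: "(real^'d) set" assume "B \<in> sets borel"
  then have "obs0 G -` B \<inter> space (base G) \<in> source_events G Initial"
    unfolding source_events.simps by blast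
  from source_event_sets[OF this] show "obs0 G -` B \<inter> space (source_algebra G) \<in> sets (source_algebra G)"
    by simp
qed simp

lemma arrival_source[measurable]: "arrival G i n \<in> borel_measurable (source_algebra G)"
  unfolding arrival_def[abs_def] by measurable

lemma chain_source:
  assumes "0 \<le> t"
  shows "chain G t \<in> measurable (source_algebra G) (count_space UNIV)"
proof (rule measurableI)
  fix A
  have "chain G t -` A \<inter> space (base G) \<in> source_events G Chain"
    unfolding source_events.simps using assms by (intro sigma_sets.Basic) blast
  from source_event_sets[OF this] show "chain G t -` A \<inter> space (source_algebra G) \<in> sets (source_algebra G)"
    by simp
qed simp

text \<open>By right-continuity the state at time \<open>S x\<close> is the eventual value of the
  states at grid times, and at grid times only countably many coordinates of the chain are read. The
  map \<open>W\<close> separates the sample point from the parameter, so that the lemma also serves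
  on product spaces.\<close>

lemma chain_at_random_time:
  assumes S[measurable]: "S \<in> borel_measurable M" and W: "W \<in> measurable M (source_algebra G)"
    and nonneg: "\<And>x. x \<in> space M \<Longrightarrow> 0 \<le> S x"
  shows "(\<lambda>x. chain G (S x) (W x)) \<in> measurable M (count_space UNIV)"
proof -
  let ?g = "\<lambda>n x. chain G (right_grid n (nat \<lfloor>S x * (real n + 1)\<rfloor>)) (W x)"
  have g: "?g n \<in> measurable M (count_space UNIV)" for n
    using measurable_compose[OF W chain_source[OF right_grid_nonneg]]
    by (rule measurable_compose_countable) measurable
  have lim: "eventually (\<lambda>n. ?g n x = chain G (S x) (W x)) sequentially" if "x \<in> space M" for x
    using chain_right_continuous[OF _ nonneg[OF that], of "W x"] measurable_space[OF W that]
      right_grid_tendsto[OF nonneg[OF that]]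
    by (auto elim!: filterlim_iff[THEN iffD1, rule_format])
  have "Measurable.pred M (\<lambda>x. chain G (S x) (W x) = i)" for i
  proof -
    \<comment> \<open>Discrete states: convergence means eventual equality, so the event is a lower
      limit of events.\<close>
    have "(chain G (S x) (W x) = i) = (\<exists>N. \<forall>n\<ge>N. ?g n x = i)" if "x \<in> space M" for x
      using lim[OF that] unfolding eventually_sequentially by (metis nle_le)
    moreover have "Measurable.pred M (\<lambda>x. \<exists>N. \<forall>n\<ge>N. ?g n x = i)"
      using g by measurable
    ultimately show ?thesis by (subst measurable_cong)
  qed
  then show ?thesis
    by (subst measurable_count_space_eq2_countable) (auto simp: pred_def vimage_def Int_def conj_commute)
qed

lemma obs_source:
  assumes "0 \<le> t"
  shows "obs G t \<in> borel_measurable (source_algebra G)"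
proof -
  \<comment> \<open>Waiting times are positive only almost surely. Truncation at 0 makes every time
    legitimate and changes nothing in \<open>obs\<close>, which sums over positive arrivals.\<close>
  have [measurable]: "(\<lambda>\<omega>. chain G (max 0 (arrival G i n \<omega>)) \<omega>) \<in> measurable (source_algebra G) (count_space UNIV)" for i n
    by (rule chain_at_random_time) measurable
  have eq: "obs G t = (\<lambda>\<omega>. obs0 G \<omega> + (\<Sum>i\<in>UNIV. \<Sum>n | 0 < arrival G i n \<omega> \<and> arrival G i n \<omega> \<le> t.
      (if chain G (max 0 (arrival G i n \<omega>)) \<omega> = i then 1 else 0) *\<^sub>R mark G i n \<omega>))"
    unfolding obs_def[abs_def] jump_integral_def
    by (intro ext arg_cong2[where f="(+)"] refl sum.cong) (auto simp: max_def)
  show ?thesis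
    unfolding eq
    by (intro borel_measurable_add borel_measurable_sum borel_measurable_sum_random_set, measurable)
qed

section \<open>The augmented filtration and the laws on it\<close>

lemma sets_raw_filtration:
  "sets (raw_filtration G t) = sigma_sets (space (base G))
     {obs G s -` B \<inter> space (base G) | s B. 0 \<le> s \<and> ennreal s \<le> t \<and> B \<in> sets borel}"
  unfolding raw_filtration_def by (rule sets_measure_of) auto

lemma space_raw_filtration: "space (raw_filtration G t) = space (base G)"
  unfolding raw_filtration_def by (rule space_measure_of) auto

lemma raw_filtration_subset_source: "sets (raw_filtration G t) \<subseteq> sets (source_algebra G)"
proof -
  have "obs G s -` B \<inter> space (base G) \<in> sets (source_algebra G)" if "0 \<le> s" "B \<in> sets borel" for s B
    using measurable_sets[OF obs_source[OF that(1)] that(2)] by simp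
  then have "{obs G s -` B \<inter> space (base G) | s B. 0 \<le> s \<and> ennreal s \<le> t \<and> B \<in> sets borel}
      \<subseteq> sets (source_algebra G)"
    by blast
  from sets.sigma_sets_subset[OF this] show ?thesis
    by (simp only: sets_raw_filtration space_source_algebra)
qed

lemma raw_filtration_mono:
  assumes "s \<le> t"
  shows "sets (raw_filtration G s) \<subseteq> sets (raw_filtration G t)"
  unfolding sets_raw_filtration
  by (intro sigma_sets_mono' Collect_mono impI; elim exE conjE; intro exI conjI)
    (assumption | erule order_trans[OF _ assms])+

lemma obs_null_sets_subset: "obs_null_sets G p \<subseteq> Pow (space (base G))"
proof
  fix N assume "N \<in> obs_null_sets G p"
  then obtain B where "B \<in> sets (raw_filtration G \<infinity>)" "N \<subseteq> B"
    by (auto simp: obs_null_sets_def)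
  then show "N \<in> Pow (space (base G))"
    using sets.sets_into_space[of B "raw_filtration G \<infinity>"] by (auto simp: space_raw_filtration)
qed

lemma sets_obs_filtration:
  "sets (obs_filtration G p t) =
     sigma_sets (space (base G)) (sets (raw_filtration G t) \<union> obs_null_sets G p)"
  unfolding obs_filtration_def
  using obs_null_sets_subset sets.space_closed[of "raw_filtration G t"]
  by (intro sets_measure_of) (simp add: space_raw_filtration)

lemma space_obs_filtration: "space (obs_filtration G p t) = space (base G)"
  unfolding obs_filtration_def
  using obs_null_sets_subset sets.space_closed[of "raw_filtration G t"]
  by (intro space_measure_of) (simp add: space_raw_filtration)

lemma filtration_obs: "filtration (space (base G)) (obs_filtration G p)"
proof
  show "sets (obs_filtration G p i) \<subseteq> sets (obs_filtration G p j)" if "i \<le> j" for i j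
    unfolding sets_obs_filtration
    by (intro sigma_sets_mono' Un_mono raw_filtration_mono[OF that] order_refl)
qed (rule space_obs_filtration)

text \<open>A common home for strategies adapted under the prior \<open>p\<close> and for the hidden
  chain. It will lie in the completions of all three laws.\<close>

definition augmented_source :: "real^'s \<Rightarrow> 'w measure" where
  "augmented_source p = sigma (space (base G)) (sets (source_algebra G) \<union> obs_null_sets G p)"

lemma sets_augmented_source:
  "sets (augmented_source p) =
     sigma_sets (space (base G)) (sets (source_algebra G) \<union> obs_null_sets G p)"
  unfolding augmented_source_def
  using obs_null_sets_subset sets.space_closed[of "source_algebra G"]
  by (intro sets_measure_of) simp

lemma space_augmented_source[simp]: "space (augmented_source p) = space (base G)"
  unfolding augmented_source_def
  using obs_null_sets_subset sets.space_closed[of "source_algebra G"]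
  by (intro space_measure_of) simp

lemma source_subset_augmented: "sets (source_algebra G) \<subseteq> sets (augmented_source p)"
  unfolding sets_augmented_source by (intro subsetI sigma_sets.Basic UnI1)

lemma obs_filtration_subset_augmented: "sets (obs_filtration G p t) \<subseteq> sets (augmented_source p)"
  unfolding sets_augmented_source sets_obs_filtration
  by (intro sigma_sets_mono' Un_mono raw_filtration_subset_source order_refl)

lemma obs_null_sets_null:
  assumes p: "p \<in> belief_simplex" and "N \<in> obs_null_sets G p"
  shows "N \<in> null_sets (cprob G p)"
proof -
  obtain B where B: "B \<in> sets (raw_filtration G \<infinity>)" "N \<subseteq> B" "emeasure (law G p) B = 0"
    using assms by (auto simp: obs_null_sets_def)
  then have "B \<in> null_sets (law G p)"
    using raw_filtration_subset_source source_algebra_subset_law[OF p] by (auto simp: null_sets_def)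
  then show ?thesis
    using B(2) null_sets_completionI null_sets_completion_subset by blast
qed

lemma subalgebra_augmented:
  assumes q: "q \<in> belief_simplex" and null: "obs_null_sets G p \<subseteq> obs_null_sets G q"
  shows "subalgebra (cprob G q) (augmented_source p)"
proof -
  have "sets (source_algebra G) \<union> obs_null_sets G p \<subseteq> sets (cprob G q)"
    using source_algebra_subset_law[OF q] obs_null_sets_null[OF q] null by (auto intro: null_setsD2)
  from sets.sigma_sets_subset[OF this] show ?thesis
    by (simp add: subalgebra_def space_law[OF q] sets_augmented_source)
qed

lemma subalgebra_obs_filtration:
  assumes p: "p \<in> belief_simplex"
  shows "subalgebra (cprob G p) (obs_filtration G p t)"
  using subalgebra_augmented[OF p order_refl] obs_filtration_subset_augmented[of p t]
  by (auto simp: subalgebra_def space_obs_filtration)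

lemma obs_null_sets_Un:
  assumes "\<And>n::nat. N n \<in> obs_null_sets G p"
    and p: "p \<in> belief_simplex"
  shows "(\<Union>n. N n) \<in> obs_null_sets G p"
proof -
  have "\<exists>B. B \<in> sets (raw_filtration G \<infinity>) \<and> N n \<subseteq> B \<and> emeasure (law G p) B = 0" for n
    using assms(1)[of n] by (simp only: obs_null_sets_def mem_Collect_eq Bex_def)
  then obtain B where B: "\<And>n. B n \<in> sets (raw_filtration G \<infinity>)" "\<And>n. N n \<subseteq> B n"
    "\<And>n. emeasure (law G p) (B n) = 0" by metis
  have "B n \<in> sets (law G p)" for n
    using B(1)[of n] raw_filtration_subset_source[of \<infinity>] source_algebra_subset_law[OF p] by blast
  then have "emeasure (law G p) (\<Union>n. B n) = 0"
    using B(3) by (intro emeasure_UN_eq_0) auto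
  moreover have "(\<Union>n. B n) \<in> sets (raw_filtration G \<infinity>)" "(\<Union>n. N n) \<subseteq> (\<Union>n. B n)"
    using B by auto
  ultimately show ?thesis
    by (simp only: obs_null_sets_def mem_Collect_eq) (rule bexI, rule conjI)
qed

lemma empty_obs_null_sets: "{} \<in> obs_null_sets G p"
  unfolding obs_null_sets_def by (rule CollectI, rule bexI[of _ "{}"]) simp_all

text \<open>Sets that agree with a source event outside an observable null set form a
  \<sigma>-algebra: complements keep the exceptional set, and countable unions take the union of the
  exceptional sets.\<close>

lemma augmented_source_approx:
  assumes p: "p \<in> belief_simplex" and "A \<in> sets (augmented_source p)"
  shows "\<exists>B N. B \<in> sets (source_algebra G) \<and> N \<in> obs_null_sets G p \<and> (A - B) \<union> (B - A) \<subseteq> N"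
  using assms(2) unfolding sets_augmented_source
proof (induction rule: sigma_sets.induct)
  case (Basic A)
  then show ?case
  proof
    assume "A \<in> sets (source_algebra G)"
    then show ?thesis
      using empty_obs_null_sets by (intro exI[of _ A] exI[of _ "{}"]) simp
  next
    assume "A \<in> obs_null_sets G p"
    then show ?thesis by (intro exI[of _ "{}"] exI[of _ A]) simp
  qed
next
  case Empty
  show ?case
    using empty_obs_null_sets by (intro exI[of _ "{}"]) simp
next
  case (Compl A)
  then obtain B N where BN: "B \<in> sets (source_algebra G)" "N \<in> obs_null_sets G p"
    "(A - B) \<union> (B - A) \<subseteq> N" by blast
  have "space (base G) - B \<in> sets (source_algebra G)"
    using sets.compl_sets[OF BN(1)] by simp
  moreover have "(space (base G) - A) - (space (base G) - B) \<union>
      ((space (base G) - B) - (space (base G) - A)) \<subseteq> N"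
    using BN(3) by blast
  ultimately show ?case using BN(2) by blast
next
  case (Union A)
  then obtain B N where B: "\<And>n. B n \<in> sets (source_algebra G)" and N: "\<And>n. N n \<in> obs_null_sets G p"
      and AB: "\<And>n. (A n - B n) \<union> (B n - A n) \<subseteq> N n"
    by metis
  have "(\<Union>n. A n) - (\<Union>n. B n) \<union> ((\<Union>n. B n) - (\<Union>n. A n)) \<subseteq> (\<Union>n. N n)"
    using AB by fast
  then show ?case
    using B obs_null_sets_Un[OF N p] by (intro exI[of _ "\<Union>n. B n"] exI[of _ "\<Union>n. N n"]) simp
qed

text \<open>The covering event is a source event, so its probability is a mixture; two nonnegative
  terms with sum 0 both vanish, and \<open>u > 0\<close>.\<close>

lemma obs_null_sets_mixture:
  assumes x: "x \<in> belief_simplex" and y: "y \<in> belief_simplex"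
    and w: "0 < u" "0 < v" "u + v = 1" and p: "u *\<^sub>R x + v *\<^sub>R y \<in> belief_simplex"
  shows "obs_null_sets G (u *\<^sub>R x + v *\<^sub>R y) \<subseteq> obs_null_sets G x"
proof
  fix N assume "N \<in> obs_null_sets G (u *\<^sub>R x + v *\<^sub>R y)"
  then obtain B where B: "B \<in> sets (raw_filtration G \<infinity>)" "N \<subseteq> B"
      "emeasure (law G (u *\<^sub>R x + v *\<^sub>R y)) B = 0"
    by (auto simp: obs_null_sets_def)
  interpret x: prob_space "law G x" by (rule law_prob[OF x])
  have "u * measure (law G x) B + v * measure (law G y) B = 0"
    using law_mixture[OF x y w p, of B] B(1,3) raw_filtration_subset_source
    by (auto simp: measure_def)
  moreover have "0 \<le> u * measure (law G x) B" "0 \<le> v * measure (law G y) B"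
    using w by (simp_all add: measure_nonneg)
  ultimately have "u * measure (law G x) B = 0" by linarith
  then have "emeasure (law G x) B = 0" using w by (simp add: x.emeasure_eq_measure)
  with B(1,2) show "N \<in> obs_null_sets G x"
    by (simp only: obs_null_sets_def mem_Collect_eq) (rule bexI, rule conjI)
qed

text \<open>One approximating source event and one exceptional set serve all three priors, because
  observable \<open>p\<close>-null sets are null for \<open>x\<close> and \<open>y\<close> too. Thus
  the identity of \<open>law_mixture\<close> passes to the augmented events.\<close>

lemma completed_law_mixture:
  assumes x: "x \<in> belief_simplex" and y: "y \<in> belief_simplex"
    and w: "0 < u" "0 < v" "u + v = 1"
  defines "p \<equiv> u *\<^sub>R x + v *\<^sub>R y"
  shows "measure_mixture (augmented_source p) (cprob G p) (cprob G x) (cprob G y) u v"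
proof -
  have p: "p \<in> belief_simplex"
    unfolding p_def using convex_belief_simplex x y w by (auto simp: convex_def)
  have nx: "obs_null_sets G p \<subseteq> obs_null_sets G x"
    using obs_null_sets_mixture[OF x y w] p by (simp add: p_def)
  have ny: "obs_null_sets G p \<subseteq> obs_null_sets G y"
    using obs_null_sets_mixture[OF y x w(2,1)] w(3) p by (simp add: p_def add.commute)
  have eq: "emeasure (cprob G q) A = ennreal (measure (law G q) B)"
    if q: "q \<in> belief_simplex" "obs_null_sets G p \<subseteq> obs_null_sets G q"
      and A: "A \<in> sets (augmented_source p)" and B: "B \<in> sets (source_algebra G)"
      and N: "N \<in> obs_null_sets G p" "(A - B) \<union> (B - A) \<subseteq> N" for q A B N
  proof -
    interpret prob_space "law G q" by (rule law_prob[OF q(1)])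
    have "N \<in> null_sets (cprob G q)" using obs_null_sets_null[OF q(1)] q(2) N(1) by blast
    then have "AE \<omega> in cprob G q. \<omega> \<in> A \<longleftrightarrow> \<omega> \<in> B"
      by (rule AE_I') (use N(2) in blast)
    moreover have "A \<in> sets (cprob G q)" "B \<in> sets (law G q)"
      using subalgebra_augmented[OF q] A B source_algebra_subset_law[OF q(1)] by (auto simp: subalgebra_def)
    ultimately have "emeasure (cprob G q) A = emeasure (cprob G q) B"
      by (intro emeasure_eq_AE) auto
    then show ?thesis using \<open>B \<in> sets (law G q)\<close> by (simp add: emeasure_eq_measure)
  qed
  show ?thesis
  proof
    fix A assume A: "A \<in> sets (augmented_source p)"
    obtain B N where BN: "B \<in> sets (source_algebra G)" "N \<in> obs_null_sets G p" "(A - B) \<union> (B - A) \<subseteq> N"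
      using augmented_source_approx[OF p A] by blast
    show "emeasure (cprob G p) A = ennreal u * emeasure (cprob G x) A + ennreal v * emeasure (cprob G y) A"
      using eq[OF p order_refl A BN] eq[OF x nx A BN] eq[OF y ny A BN] law_mixture[OF x y w _ BN(1)] p w
      by (simp add: p_def ennreal_plus ennreal_mult measure_nonneg)
  qed (use w subalgebra_augmented[OF p order_refl] subalgebra_augmented[OF x nx] subalgebra_augmented[OF y ny] in auto)
qed

text \<open>Beliefs are evaluated at random times, so one exceptional set must work for all times.
  At a fixed time the conditional probabilities are nonnegative and add up to 1 almost surely;
  countably many grid times, right-continuity and closedness of the simplex give the rest.\<close>

lemma belief_in_simplex_AE:
  assumes p: "p \<in> belief_simplex"
  shows "AE \<omega> in cprob G p. \<forall>t\<ge>0. belief G p t \<omega> \<in> belief_simplex"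
proof -
  interpret law: prob_space "law G p" by (rule law_prob[OF p])
  interpret prob_space "cprob G p" by (rule law.prob_space_completion)
  have fixed: "AE \<omega> in cprob G p. belief G p t \<omega> \<in> belief_simplex" if t: "0 \<le> t" for t
  proof -
    let ?F = "obs_filtration G p (ennreal t)"
    let ?I = "\<lambda>i. indicator {\<omega> \<in> space (base G). chain G t \<omega> = i} :: 'w \<Rightarrow> real"
    interpret finite_measure_subalgebra "cprob G p" ?F
      by unfold_locales (rule subalgebra_obs_filtration[OF p])
    interpret sigma_finite_subalgebra "cprob G p" ?F
      by (rule finite_measure_subalgebra_is_sigma_finite) unfold_locales
    have "{\<omega> \<in> space (base G). chain G t \<omega> = i} \<in> sets (law G p)" for i
      using measurable_sets[OF chain_measurable[OF t], of "{i}"] law_sets[OF p]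
      by (simp add: vimage_def Int_def conj_commute)
    then have "{\<omega> \<in> space (base G). chain G t \<omega> = i} \<in> sets (cprob G p)" for i
      by (rule sets_completionI_sets)
    then have meas[measurable]: "?I i \<in> borel_measurable (cprob G p)" for i
      by (rule borel_measurable_indicator)
    have int: "integrable (cprob G p) (?I i)" for i
      by (rule integrable_const_bound[where B=1]) (auto simp: indicator_def intro: meas)
    have "AE \<omega> in cprob G p. \<forall>i. real_cond_exp (cprob G p) ?F (?I i) \<omega> \<ge> 0"
      by (subst AE_all_countable) (auto intro!: real_cond_exp_pos)
    moreover have "AE \<omega> in cprob G p. (\<Sum>i\<in>UNIV. real_cond_exp (cprob G p) ?F (?I i) \<omega>) = 1"
    proof -
      have "AE \<omega> in cprob G p. (\<Sum>i\<in>UNIV. ?I i \<omega>) = 1"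
        by (rule AE_I2) (simp add: space_law[OF p] indicator_def)
      then have "AE \<omega> in cprob G p. real_cond_exp (cprob G p) ?F (\<lambda>\<omega>. \<Sum>i\<in>UNIV. ?I i \<omega>) \<omega> =
          real_cond_exp (cprob G p) ?F (\<lambda>_. 1) \<omega>"
        by (rule real_cond_exp_cong) measurable
      moreover have "AE \<omega> in cprob G p. real_cond_exp (cprob G p) ?F (\<lambda>\<omega>. \<Sum>i\<in>UNIV. ?I i \<omega>) \<omega> =
          (\<Sum>i\<in>UNIV. real_cond_exp (cprob G p) ?F (?I i) \<omega>)"
        by (rule real_cond_exp_sum) (rule int)
      moreover have "AE \<omega> in cprob G p. real_cond_exp (cprob G p) ?F (\<lambda>_. 1) \<omega> = 1"
        by (rule real_cond_exp_F_meas) auto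
      ultimately show ?thesis by eventually_elim simp
    qed
    moreover have "AE \<omega> in cprob G p. \<forall>i. belief G p t \<omega> $ i = real_cond_exp (cprob G p) ?F (?I i) \<omega>"
      by (subst AE_all_countable) (auto intro!: belief_cond_prob[OF p t])
    ultimately show ?thesis
    proof eventually_elim
      case (elim \<omega>)
      have "belief G p t \<omega> $ i \<le> (\<Sum>i\<in>UNIV. belief G p t \<omega> $ i)" for i
        using elim by (intro member_le_sum) auto
      with elim show ?case by (simp add: belief_simplex_def)
    qed
  qed
  have "AE \<omega> in cprob G p. \<forall>n k. belief G p (right_grid n k) \<omega> \<in> belief_simplex"
    by (simp add: AE_all_countable fixed right_grid_nonneg)
  then show ?thesis
    using belief_right_continuous[OF p]
  proof eventually_elim
    case (elim \<omega>)
    show ?case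
    proof (intro allI impI)
      fix t :: real assume t: "0 \<le> t"
      have "(\<lambda>n. belief G p (right_grid n (nat \<lfloor>t * (real n + 1)\<rfloor>)) \<omega>) \<longlonglongrightarrow> belief G p t \<omega>"
        using elim(2) t by (intro filterlim_compose[OF _ right_grid_tendsto[OF t]]) blast
      then show "belief G p t \<omega> \<in> belief_simplex"
        by (rule closed_sequentially[OF closed_belief_simplex, rotated]) (simp add: elim(1))
    qed
  qed
qed

end

text \<open>Covers nonintegrable \<open>f\<close> as well, whose integral is 0 by convention. Bounds
  on the running benefit can thus be stated for every sample point.\<close>

lemma abs_set_integral_le:
  fixes f :: "real \<Rightarrow> real"
  assumes "0 \<le> T" "\<And>t. t \<in> {0..T} \<Longrightarrow> \<bar>f t\<bar> \<le> C"
  shows "\<bar>LINT t:{0..T}|lborel. f t\<bar> \<le> C * T"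
proof (cases "set_integrable lborel {0..T} f")
  case True
  then have int: "integrable lborel (\<lambda>t. indicator {0..T} t *\<^sub>R f t)"
    by (simp add: set_integrable_def)
  have "\<bar>LINT t:{0..T}|lborel. f t\<bar> \<le> (\<integral>t. \<bar>indicator {0..T} t *\<^sub>R f t\<bar> \<partial>lborel)"
    unfolding set_lebesgue_integral_def by (rule integral_abs_bound)
  also have "\<dots> \<le> (\<integral>t. C * indicator {0..T} t \<partial>lborel)"
  proof (rule integral_mono)
    show "integrable lborel (\<lambda>t. C * indicator {0..T} t)"
      by (intro integrable_mult_right integrable_real_indicator) (auto simp: emeasure_lborel_Icc_eq)
  qed (use int assms(2) in \<open>auto split: split_indicator\<close>)
  also have "\<dots> = C * T" using assms(1) by simp
  finally show ?thesis .
next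
  case False
  have "0 \<le> C" using assms(2)[of 0] assms(1) by simp
  then have "0 \<le> C * T" using assms(1) by simp
  moreover have "(LINT t:{0..T}|lborel. f t) = 0"
    using False unfolding set_integrable_def set_lebesgue_integral_def
    by (rule not_integrable_integral_eq)
  ultimately show ?thesis by simp
qed

lemma (in prob_space) integral_le_AE_const:
  fixes f :: "'a \<Rightarrow> real"
  assumes "AE x in M. f x \<le> c" "0 \<le> c"
  shows "(\<integral>x. f x \<partial>M) \<le> c"
proof (cases "integrable M f")
  case True
  then show ?thesis using assms(1) by (rule integral_le_const)
next
  case False
  then show ?thesis using assms(2) by (simp add: not_integrable_integral_eq)
qed

section \<open>Admissible strategies and the convexity of the value function\<close>

text \<open>The same random variable under every prior, hence the quantity through which
  admissibility is transferred. Index 0 is the initial policy and is not counted.\<close>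

definition number_of_switches :: "(nat \<Rightarrow> 'w \<Rightarrow> ennreal) \<Rightarrow> 'w \<Rightarrow> ennreal" where
  "number_of_switches \<tau> \<omega> = (\<Sum>k. if \<tau> (Suc k) \<omega> < \<infinity> then 1 else 0)"

context switching_model
begin

lemma switch_cost_bounds:
  obtains k K where "0 < k" "0 < K" "\<And>i a b. k \<le> switch_cost G i a b" "\<And>i a b. switch_cost G i a b \<le> K"
proof -
  obtain k where k: "0 < k" "\<And>i a b. k < switch_cost G i a b"
    using switch_cost_lower by blast
  let ?R = "range (\<lambda>(i, a, b). switch_cost G i a b)"
  have le: "switch_cost G i a b \<le> Max ?R" for i a b
    by (rule Max_ge) (auto intro: range_eqI[of _ _ "(i, a, b)"])
  show thesis
  proof (rule that)
    show "k \<le> switch_cost G i a b" for i a b using k(2) by (rule less_imp_le)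
    show "0 < Max ?R" using k(1) k(2) le by (meson less_le_trans order_less_trans)
  qed (use k(1) le in auto)
qed

lemma benefit_bound:
  obtains C where "0 \<le> C" "\<And>i b. \<bar>benefit G i b\<bar> \<le> C"
proof -
  let ?R = "range (\<lambda>(i, b). \<bar>benefit G i b\<bar>)"
  have le: "\<bar>benefit G i b\<bar> \<le> Max ?R" for i b
    by (rule Max_ge) (auto intro: range_eqI[of _ _ "(i, b)"])
  then have "0 \<le> Max ?R" by (rule order_trans[OF abs_ge_zero])
  with le show thesis by (rule that[rotated])
qed

lemma mean_switch_cost_bounds:
  assumes "q \<in> belief_simplex" "\<And>i a b. k \<le> switch_cost G i a b" "\<And>i a b. switch_cost G i a b \<le> K"
  shows "k \<le> mean_switch_cost G a b q" "mean_switch_cost G a b q \<le> K"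
proof -
  have q: "\<And>i. 0 \<le> q $ i" "(\<Sum>i\<in>UNIV. q $ i) = 1"
    using assms(1) by (auto simp: belief_simplex_def)
  have "k = (\<Sum>i\<in>UNIV. k * q $ i)" "K = (\<Sum>i\<in>UNIV. K * q $ i)"
    using q(2) by (simp_all flip: sum_distrib_left)
  moreover have "(\<Sum>i\<in>UNIV. k * q $ i) \<le> mean_switch_cost G a b q"
      "mean_switch_cost G a b q \<le> (\<Sum>i\<in>UNIV. K * q $ i)"
    unfolding mean_switch_cost_def using q(1) assms(2,3) by (auto intro!: sum_mono mult_right_mono)
  ultimately show "k \<le> mean_switch_cost G a b q" "mean_switch_cost G a b q \<le> K"
    by simp_all
qed

lemma discount_factor_bounds:
  assumes "t \<in> {0..T}"
  shows "exp (- discount G * T) \<le> exp (- discount G * t)" "exp (- discount G * t) \<le> 1"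
  using assms discount_nonneg by (auto simp: mult_left_mono)

text \<open>On a belief path in the simplex, the discounted cost of every switch before \<open>T\<close> lies between
  two positive constants, so integrability of the costs does not depend on the belief process.\<close>

lemma switching_cost_comparable:
  assumes q: "q \<in> belief_simplex"
    and \<tau>: "\<And>\<omega> k. \<omega> \<in> space (base G) \<Longrightarrow> \<tau> k \<omega> \<le> ennreal T \<or> \<tau> k \<omega> = \<infinity>" and "0 \<le> T"
    and N: "number_of_switches \<tau> \<in> borel_measurable (cprob G q)"
  shows "(\<integral>\<^sup>+\<omega>. (\<Sum>k. if \<tau> (Suc k) \<omega> < \<infinity>
        then ennreal (exp (- discount G * enn2real (\<tau> (Suc k) \<omega>)) *
          mean_switch_cost G (\<xi> k \<omega>) (\<xi> (Suc k) \<omega>) (belief G q (enn2real (\<tau> (Suc k) \<omega>)) \<omega>))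
        else 0) \<partial>cprob G q) < \<infinity> \<longleftrightarrow> (\<integral>\<^sup>+\<omega>. number_of_switches \<tau> \<omega> \<partial>cprob G q) < \<infinity>"
    (is "(\<integral>\<^sup>+\<omega>. ?cost \<omega> \<partial>_) < _ \<longleftrightarrow> _")
proof -
  obtain k K where kK: "0 < k" "0 < K" "\<And>i a b. k \<le> switch_cost G i a b" "\<And>i a b. switch_cost G i a b \<le> K"
    using switch_cost_bounds by blast
  \<comment> \<open>The smallest discount factor on \<open>[0, T]\<close> times a positive lower
    bound for the costs.\<close>
  let ?l = "exp (- discount G * T) * k"
  have l: "0 < ?l" using kK(1) by simp
  have switch_bounds: "?l \<le> exp (- discount G * enn2real t) * mean_switch_cost G a b z \<and>
      exp (- discount G * enn2real t) * mean_switch_cost G a b z \<le> K"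
    if "t \<le> ennreal T" "z \<in> belief_simplex" for t z a b
  proof -
    have "enn2real t \<in> {0..T}"
      using that(1) \<open>0 \<le> T\<close> by (simp add: enn2real_leI)
    note d = discount_factor_bounds[OF this]
    note m = mean_switch_cost_bounds[OF that(2) kK(3,4), of a b]
    have "?l \<le> exp (- discount G * enn2real t) * mean_switch_cost G a b z"
      using d m kK(1) by (intro mult_mono) auto
    moreover have "exp (- discount G * enn2real t) * mean_switch_cost G a b z \<le> 1 * K"
      using d m kK(1) by (intro mult_mono) auto
    ultimately show ?thesis by simp
  qed
  have bounds: "AE \<omega> in cprob G q. ennreal ?l * number_of_switches \<tau> \<omega> \<le> ?cost \<omega> \<and>
      ?cost \<omega> \<le> ennreal K * number_of_switches \<tau> \<omega>"
    using belief_in_simplex_AE[OF q] AE_space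
  proof eventually_elim
    case (elim \<omega>)
    have \<omega>: "\<omega> \<in> space (base G)" using elim(2) by (simp add: space_law[OF q])
    have le: "\<tau> k \<omega> \<le> ennreal T" if "\<tau> k \<omega> < \<infinity>" for k
      using \<tau>[OF \<omega>, of k] that by auto
    have "belief G q (enn2real (\<tau> k \<omega>)) \<omega> \<in> belief_simplex" for k
      using elim(1) by simp
    then show ?case
      unfolding number_of_switches_def ennreal_suminf_cmult[symmetric]
      using switch_bounds[OF le] by (intro conjI suminf_le summableI) (auto intro!: ennreal_leI)
  qed
  show ?thesis
  proof
    assume "(\<integral>\<^sup>+\<omega>. ?cost \<omega> \<partial>cprob G q) < \<infinity>"
    \<comment> \<open>Only monotonicity is applied to the cost, so its measurability, with the
      belief read at a random time, never comes up; the constant factor is moved only across the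
      switch count.\<close>
    moreover have "(\<integral>\<^sup>+\<omega>. ennreal ?l * number_of_switches \<tau> \<omega> \<partial>cprob G q) \<le> (\<integral>\<^sup>+\<omega>. ?cost \<omega> \<partial>cprob G q)"
      using bounds by (intro nn_integral_mono_AE) auto
    ultimately have "ennreal ?l * (\<integral>\<^sup>+\<omega>. number_of_switches \<tau> \<omega> \<partial>cprob G q) < \<infinity>"
      using N by (simp add: nn_integral_cmult)
    then show "(\<integral>\<^sup>+\<omega>. number_of_switches \<tau> \<omega> \<partial>cprob G q) < \<infinity>"
      using l by (auto simp: ennreal_mult_less_top)
  next
    assume "(\<integral>\<^sup>+\<omega>. number_of_switches \<tau> \<omega> \<partial>cprob G q) < \<infinity>"
    then have "(\<integral>\<^sup>+\<omega>. ennreal K * number_of_switches \<tau> \<omega> \<partial>cprob G q) < \<infinity>"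
      using N by (simp add: nn_integral_cmult ennreal_mult_less_top)
    moreover have "(\<integral>\<^sup>+\<omega>. ?cost \<omega> \<partial>cprob G q) \<le> (\<integral>\<^sup>+\<omega>. ennreal K * number_of_switches \<tau> \<omega> \<partial>cprob G q)"
      using bounds by (intro nn_integral_mono_AE) auto
    ultimately show "(\<integral>\<^sup>+\<omega>. ?cost \<omega> \<partial>cprob G q) < \<infinity>" by simp
  qed
qed

text \<open>Witness that the supremum in \<open>value_fn\<close> runs over a nonempty set.\<close>

lemma never_switch_admissible:
  assumes "0 \<le> T"
  shows "(\<lambda>k _. if k = 0 then 0 else \<infinity>, \<lambda>_ _. a) \<in> admissible G T p a"
proof -
  have "(\<lambda>_. a) \<in> measurable M (count_space UNIV)" for M :: "'w measure" by simp
  moreover have "stopping_time (obs_filtration G p) (\<lambda>_. if k = 0 then 0 else \<infinity>)" for k :: nat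
    by (rule stopping_time_const)
  moreover have "AE \<omega> in cprob G p. \<exists>k::nat. (if k = 0 then 0 else \<infinity> :: ennreal) = \<infinity>"
    by (rule AE_I2) (rule exI[of _ 1], simp)
  ultimately show ?thesis unfolding admissible_def by simp
qed

end

section \<open>One admissible strategy: measurability, payoff and change of prior\<close>

locale admissible_strategy = switching_model G
  for G :: "('w, 's::finite, 'd::finite, 'p::finite) model" +
  fixes T :: real and p :: "real^'s" and a :: 'p
    and \<tau> :: "nat \<Rightarrow> 'w \<Rightarrow> ennreal" and \<xi> :: "nat \<Rightarrow> 'w \<Rightarrow> 'p"
  assumes horizon_nonneg: "0 \<le> T" and prior: "p \<in> belief_simplex"
    and adm: "(\<tau>, \<xi>) \<in> admissible G T p a"
begin

abbreviation H :: "'w measure" where "H \<equiv> augmented_source p"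

lemma switch_times:
  assumes "\<omega> \<in> space (base G)"
  shows "\<tau> 0 \<omega> = 0" "\<xi> 0 \<omega> = a" "\<tau> k \<omega> \<le> ennreal T \<or> \<tau> k \<omega> = \<infinity>"
    "if \<tau> k \<omega> < \<infinity> then \<tau> k \<omega> < \<tau> (Suc k) \<omega> else \<tau> (Suc k) \<omega> = \<infinity>"
  using adm assms unfolding admissible_def by blast+

lemma stopping: "stopping_time (obs_filtration G p) (\<tau> k)"
  using adm unfolding admissible_def by blast

lemma choice_measurable:
  "\<xi> k \<in> measurable (filtration.pre_sigma (space (base G)) (obs_filtration G p) (\<tau> k)) (count_space UNIV)"
  using adm unfolding admissible_def by blast

lemma finitely_many_switches: "AE \<omega> in cprob G p. \<exists>k. \<tau> k \<omega> = \<infinity>"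
  using adm unfolding admissible_def by blast

lemma switch_times_mono:
  assumes "\<omega> \<in> space (base G)" "j \<le> k"
  shows "\<tau> j \<omega> \<le> \<tau> k \<omega>"
proof (rule lift_Suc_mono_le[where f = "\<lambda>k. \<tau> k \<omega>", OF _ assms(2)])
  show "\<tau> n \<omega> \<le> \<tau> (Suc n) \<omega>" for n
    using switch_times(4)[OF assms(1), of n] by (auto split: if_splits)
qed

lemma switch_time_H[measurable]: "\<tau> k \<in> borel_measurable H"
  using obs_filtration_subset_augmented
  by (rule measurable_stopping_time[OF stopping]) (simp add: space_obs_filtration)

lemma choice_H[measurable]: "\<xi> k \<in> measurable H (count_space UNIV)"
proof -
  interpret filtration "space (base G)" "obs_filtration G p" by (rule filtration_obs)
  have "sets (pre_sigma (\<tau> k)) \<subseteq> sets H"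
  proof
    fix A assume "A \<in> sets (pre_sigma (\<tau> k))"
    \<comment> \<open>At the time \<infinity> the defining condition of the stopped \<sigma>-algebra
      returns \<open>A\<close> itself.\<close>
    then have "{\<omega> \<in> A. \<tau> k \<omega> \<le> \<infinity>} \<in> sets (obs_filtration G p \<infinity>)"
      by (rule sets_pre_sigmaD[OF stopping])
    then show "A \<in> sets H" using obs_filtration_subset_augmented by auto
  qed
  then show ?thesis
    using choice_measurable[of k] measurable_mono[OF order_refl refl, of "pre_sigma (\<tau> k)" H "count_space UNIV"]
    by (auto simp: space_pre_sigma)
qed

lemma number_of_switches_H[measurable]: "number_of_switches \<tau> \<in> borel_measurable H"
  unfolding number_of_switches_def[abs_def] by measurable

lemma expected_switches_finite: "(\<integral>\<^sup>+\<omega>. number_of_switches \<tau> \<omega> \<partial>cprob G p) < \<infinity>"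
proof -
  have "number_of_switches \<tau> \<in> borel_measurable (cprob G p)"
    by (rule measurable_from_subalg[OF subalgebra_augmented[OF prior order_refl]]) measurable
  note iff = switching_cost_comparable[OF prior _ horizon_nonneg this, of \<xi>]
  show ?thesis
    using adm switch_times(3) unfolding admissible_def by (subst iff[symmetric]) blast+
qed

lemma ident_source: "(\<lambda>\<omega>. \<omega>) \<in> measurable H (source_algebra G)"
proof (rule measurableI)
  fix A assume A: "A \<in> sets (source_algebra G)"
  then have "(\<lambda>\<omega>. \<omega>) -` A \<inter> space H = A"
    using sets.sets_into_space[OF A] by auto
  with A show "(\<lambda>\<omega>. \<omega>) -` A \<inter> space H \<in> sets H"
    using source_subset_augmented by auto
qed simp

lemma chain_H:
  assumes "S \<in> borel_measurable H" "\<And>\<omega>. \<omega> \<in> space (base G) \<Longrightarrow> 0 \<le> S \<omega>"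
  shows "(\<lambda>\<omega>. chain G (S \<omega>) \<omega>) \<in> measurable H (count_space UNIV)"
  using assms by (intro chain_at_random_time[OF _ ident_source]) auto

lemma chain_joint:
  "(\<lambda>x. chain G (max 0 (snd x)) (fst x)) \<in> measurable (H \<Otimes>\<^sub>M lborel) (count_space UNIV)"
  by (rule chain_at_random_time[OF _ measurable_compose[OF measurable_fst ident_source]]) auto

text \<open>Monotone switching times make the index in \<open>policy_at\<close> unique. Where no
  index exists, \<open>THE\<close> takes one fixed default value, which does not disturb
  measurability.\<close>

lemma policy_joint:
  "(\<lambda>x. policy_at (\<tau>, \<xi>) (snd x) (fst x)) \<in> measurable (H \<Otimes>\<^sub>M lborel) (count_space UNIV)"
proof -
  have "(\<lambda>x. THE k. \<tau> k (fst x) \<le> ennreal (snd x) \<and> ennreal (snd x) < \<tau> (Suc k) (fst x))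
      \<in> measurable (H \<Otimes>\<^sub>M lborel) (count_space UNIV)"
  proof (rule measurable_THE[where I=UNIV])
    fix x :: "'w \<times> real" and i j
    assume x: "x \<in> space (H \<Otimes>\<^sub>M lborel)"
      and i: "\<tau> i (fst x) \<le> ennreal (snd x) \<and> ennreal (snd x) < \<tau> (Suc i) (fst x)"
      and j: "\<tau> j (fst x) \<le> ennreal (snd x) \<and> ennreal (snd x) < \<tau> (Suc j) (fst x)"
    have "\<tau> m (fst x) \<le> \<tau> n (fst x)" if "m \<le> n" for m n
      using x that by (intro switch_times_mono) (auto simp: space_pair_measure)
    then have "\<not> Suc i \<le> j" "\<not> Suc j \<le> i"
      using i j by (meson leD order_trans)+
    then show "i = j" by simp
  qed measurable
  then show ?thesis
    unfolding policy_at_def fst_conv snd_conv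
    by (rule measurable_compose_countable[rotated]) measurable
qed

definition gain :: "'w \<Rightarrow> real" where
  "gain \<omega> = (LINT t:{0..T}|lborel. exp (- discount G * t) *
        (\<Sum>i\<in>UNIV. benefit G i (policy_at (\<tau>, \<xi>) t \<omega>) * (if chain G t \<omega> = i then 1 else 0)))"

definition paid :: "'w \<Rightarrow> real" where
  "paid \<omega> = (\<Sum>k. if \<tau> (Suc k) \<omega> < \<infinity>
          then exp (- discount G * enn2real (\<tau> (Suc k) \<omega>)) *
            (\<Sum>i\<in>UNIV. switch_cost G i (\<xi> k \<omega>) (\<xi> (Suc k) \<omega>) *
               (if chain G (enn2real (\<tau> (Suc k) \<omega>)) \<omega> = i then 1 else 0))
          else 0)"

lemma performance_eq: "performance G T q (\<tau>, \<xi>) = (\<integral>\<omega>. gain \<omega> - paid \<omega> \<partial>cprob G q)"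
  unfolding performance_def gain_def paid_def fst_conv snd_conv ..

lemma gain_H[measurable]: "gain \<in> borel_measurable H"
proof -
  note [measurable] = chain_joint
  have [measurable]: "(\<lambda>x. benefit G i (policy_at (\<tau>, \<xi>) (snd x) (fst x))) \<in> borel_measurable (H \<Otimes>\<^sub>M lborel)" for i
    using policy_joint by (rule measurable_compose) simp
  \<comment> \<open>The integrand extended to all real \<open>t\<close>: \<open>max 0 t\<close>
    supplies the nonnegative time required by \<open>chain_joint\<close> and equals \<open>t\<close>
    wherever the indicator is nonzero.\<close>
  define F where "F \<omega> t = indicator {0..T} t * (exp (- discount G * t) *
      (\<Sum>i\<in>UNIV. benefit G i (policy_at (\<tau>, \<xi>) t \<omega>) * (if chain G (max 0 t) \<omega> = i then 1 else 0)))" for \<omega> t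
  have "case_prod F \<in> borel_measurable (H \<Otimes>\<^sub>M lborel)"
    unfolding F_def split_beta' by measurable
  then have "(\<lambda>\<omega>. \<integral>t. F \<omega> t \<partial>lborel) \<in> borel_measurable H"
    by (rule lborel.borel_measurable_lebesgue_integral)
  moreover have "gain = (\<lambda>\<omega>. \<integral>t. F \<omega> t \<partial>lborel)"
    unfolding gain_def[abs_def] set_lebesgue_integral_def
    by (intro ext Bochner_Integration.integral_cong refl)
      (simp add: F_def max_def split: split_indicator)
  ultimately show ?thesis by simp
qed

lemma paid_H[measurable]: "paid \<in> borel_measurable H"
proof -
  have [measurable]: "(\<lambda>\<omega>. chain G (enn2real (\<tau> k \<omega>)) \<omega>) \<in> measurable H (count_space UNIV)" for k
    by (rule chain_H) auto
  have [measurable]: "(\<lambda>\<omega>. switch_cost G i (\<xi> k \<omega>) (\<xi> (Suc k) \<omega>)) \<in> borel_measurable H" for i k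
  proof (rule measurable_compose_countable[where f = "\<lambda>b \<omega>. switch_cost G i b (\<xi> (Suc k) \<omega>)", OF _ choice_H])
    show "(\<lambda>\<omega>. switch_cost G i b (\<xi> (Suc k) \<omega>)) \<in> borel_measurable H" for b
      using choice_H by (rule measurable_compose) simp
  qed
  show ?thesis unfolding paid_def[abs_def] by measurable
qed

lemma abs_gain_le:
  assumes "\<And>i b. \<bar>benefit G i b\<bar> \<le> C"
  shows "\<bar>gain \<omega>\<bar> \<le> C * T"
  unfolding gain_def
proof (rule abs_set_integral_le[OF horizon_nonneg])
  fix t assume "t \<in> {0..T}"
  from discount_factor_bounds(2)[OF this]
  have "exp (- discount G * t) * \<bar>benefit G i b\<bar> \<le> 1 * C" for i b
    using assms by (intro mult_mono) auto
  then show "\<bar>exp (- discount G * t) * (\<Sum>i\<in>UNIV. benefit G i (policy_at (\<tau>, \<xi>) t \<omega>) *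
      (if chain G t \<omega> = i then 1 else 0))\<bar> \<le> C"
    by (simp add: abs_mult if_distrib cong: if_cong)
qed

lemma paid_bounds:
  assumes "\<omega> \<in> space (base G)" "\<exists>k. \<tau> k \<omega> = \<infinity>"
    and cost: "\<And>i a b. 0 \<le> switch_cost G i a b" "\<And>i a b. switch_cost G i a b \<le> K"
  shows "0 \<le> paid \<omega>" "ennreal (paid \<omega>) \<le> ennreal K * number_of_switches \<tau> \<omega>"
proof -
  let ?c = "\<lambda>k. if \<tau> (Suc k) \<omega> < \<infinity>
          then exp (- discount G * enn2real (\<tau> (Suc k) \<omega>)) *
            (\<Sum>i\<in>UNIV. switch_cost G i (\<xi> k \<omega>) (\<xi> (Suc k) \<omega>) *
               (if chain G (enn2real (\<tau> (Suc k) \<omega>)) \<omega> = i then 1 else 0))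
          else 0"
  \<comment> \<open>From the index \<open>m\<close> on all terms vanish, so the series is summable
    and its \<open>suminf\<close> can be estimated termwise.\<close>
  obtain m where m: "\<tau> m \<omega> = \<infinity>" using assms(2) by blast
  have "\<tau> (Suc k) \<omega> = \<infinity>" if "k \<ge> m" for k
    using switch_times_mono[OF assms(1), of m "Suc k"] that m by (simp add: top_unique)
  then have summable: "summable ?c"
    by (intro summable_finite[of "{..<m}"]) (auto simp: not_less)
  have c: "0 \<le> ?c k \<and> ?c k \<le> (if \<tau> (Suc k) \<omega> < \<infinity> then K else 0)" for k
  proof (cases "\<tau> (Suc k) \<omega> < \<infinity>")
    case True
    then have "enn2real (\<tau> (Suc k) \<omega>) \<in> {0..T}"
      using switch_times(3)[OF assms(1), of "Suc k"] horizon_nonneg by (auto simp: enn2real_leI)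
    from discount_factor_bounds(2)[OF this]
    have "exp (- discount G * enn2real (\<tau> (Suc k) \<omega>)) * switch_cost G i b c \<le> 1 * K" for i b c
      using cost by (intro mult_mono) auto
    with True cost show ?thesis by (simp add: if_distrib cong: if_cong)
  qed simp
  show "0 \<le> paid \<omega>"
    unfolding paid_def using c by (intro suminf_nonneg summable) blast
  have "ennreal (paid \<omega>) = (\<Sum>k. ennreal (?c k))"
    unfolding paid_def using c by (intro suminf_ennreal2[symmetric] summable) blast
  also have "\<dots> \<le> (\<Sum>k. ennreal K * (if \<tau> (Suc k) \<omega> < \<infinity> then 1 else 0))"
  proof (intro suminf_le summableI)
    show "ennreal (?c k) \<le> ennreal K * (if \<tau> (Suc k) \<omega> < \<infinity> then 1 else 0)" for k
      using ennreal_leI[OF conjunct2[OF c[of k]]] by (simp split: if_splits)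
  qed
  also have "\<dots> = ennreal K * number_of_switches \<tau> \<omega>"
    unfolding number_of_switches_def by (rule ennreal_suminf_cmult)
  finally show "ennreal (paid \<omega>) \<le> ennreal K * number_of_switches \<tau> \<omega>" .
qed

lemma integrable_payoff: "integrable (cprob G p) (\<lambda>\<omega>. gain \<omega> - paid \<omega>)"
proof (rule Bochner_Integration.integrable_diff)
  interpret law: prob_space "law G p" by (rule law_prob[OF prior])
  interpret prob_space "cprob G p" by (rule law.prob_space_completion)
  note from_H = measurable_from_subalg[OF subalgebra_augmented[OF prior order_refl]]
  note [measurable] = from_H[OF gain_H] from_H[OF paid_H] from_H[OF number_of_switches_H]
  obtain C where "\<And>i b. \<bar>benefit G i b\<bar> \<le> C" using benefit_bound by blast
  then show "integrable (cprob G p) gain"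
    by (intro integrable_const_bound[where B = "C * T"]) (auto intro!: abs_gain_le)
  obtain k K where kK: "0 < k" "0 < K" "\<And>i a b. k \<le> switch_cost G i a b" "\<And>i a b. switch_cost G i a b \<le> K"
    using switch_cost_bounds by blast
  have nonneg: "0 \<le> switch_cost G i a b" for i a b using kK(1) kK(3)[of i a b] by linarith
  have "AE \<omega> in cprob G p. ennreal (norm (paid \<omega>)) \<le> ennreal K * number_of_switches \<tau> \<omega>"
    using finitely_many_switches AE_space
  proof eventually_elim
    case (elim \<omega>)
    then show ?case
      using paid_bounds[OF _ elim(1) nonneg kK(4)] by (simp add: space_law[OF prior])
  qed
  then have "(\<integral>\<^sup>+\<omega>. ennreal (norm (paid \<omega>)) \<partial>cprob G p) \<le> (\<integral>\<^sup>+\<omega>. ennreal K * number_of_switches \<tau> \<omega> \<partial>cprob G p)"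
    by (rule nn_integral_mono_AE)
  also have "\<dots> < \<infinity>"
    using expected_switches_finite by (simp add: nn_integral_cmult ennreal_mult_less_top)
  finally show "integrable (cprob G p) paid"
    by (intro integrableI_bounded) auto
qed

text \<open>Switching only costs, and the bound is the same for all strategies; this makes the real
  supremum in \<open>value_fn\<close> meaningful.\<close>

lemma performance_le:
  assumes C: "0 \<le> C" "\<And>i b. \<bar>benefit G i b\<bar> \<le> C"
  shows "performance G T p (\<tau>, \<xi>) \<le> C * T"
proof -
  interpret law: prob_space "law G p" by (rule law_prob[OF prior])
  interpret prob_space "cprob G p" by (rule law.prob_space_completion)
  obtain k K where kK: "0 < k" "0 < K" "\<And>i a b. k \<le> switch_cost G i a b" "\<And>i a b. switch_cost G i a b \<le> K"
    using switch_cost_bounds by blast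
  have nonneg: "0 \<le> switch_cost G i a b" for i a b using kK(1) kK(3)[of i a b] by linarith
  have "AE \<omega> in cprob G p. gain \<omega> - paid \<omega> \<le> C * T"
    using finitely_many_switches AE_space
  proof eventually_elim
    case (elim \<omega>)
    then have "0 \<le> paid \<omega>"
      using paid_bounds(1)[OF _ elim(1) nonneg kK(4)] by (simp add: space_law[OF prior])
    with abs_gain_le[OF C(2), of \<omega>] show ?case by linarith
  qed
  then show ?thesis
    unfolding performance_eq using C(1) horizon_nonneg by (intro integral_le_AE_const) auto
qed

text \<open>Adaptedness passes to \<open>x\<close> because its filtration is larger; the cost
  condition passes through the expected number of switches, since the costs under \<open>p\<close>
  and \<open>x\<close> involve different beliefs. With \<open>R\<close> arbitrary, the second
  component follows by \<open>swap\<close>.\<close>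

lemma admissible_component:
  assumes mix: "measure_mixture H (cprob G p) (cprob G x) R u v"
    and x: "x \<in> belief_simplex" and null: "obs_null_sets G p \<subseteq> obs_null_sets G x"
  shows "(\<tau>, \<xi>) \<in> admissible G T x a"
proof -
  interpret m: measure_mixture H "cprob G p" "cprob G x" R u v by (rule mix)
  have sub: "sets (obs_filtration G p t) \<subseteq> sets (obs_filtration G x t)" for t
    unfolding sets_obs_filtration by (intro sigma_sets_mono' Un_mono order_refl null)
  have stop: "stopping_time (obs_filtration G x) (\<tau> k)" for k
  proof
    fix t
    show "Measurable.pred (obs_filtration G x t) (\<lambda>\<omega>. \<tau> k \<omega> \<le> t)"
      using stopping_timeD[OF stopping, of k t] sub[of t] by (auto simp: pred_def space_obs_filtration)
  qed
  interpret Fp: filtration "space (base G)" "obs_filtration G p" by (rule filtration_obs)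
  interpret Fx: filtration "space (base G)" "obs_filtration G x" by (rule filtration_obs)
  have "sets (Fp.pre_sigma (\<tau> k)) \<subseteq> sets (Fx.pre_sigma (\<tau> k))" for k
    unfolding Fp.sets_pre_sigma[OF stopping] Fx.sets_pre_sigma[OF stop] using sub by fast
  then have "\<xi> k \<in> measurable (Fx.pre_sigma (\<tau> k)) (count_space UNIV)" for k
    using choice_measurable[of k]
      measurable_mono[OF order_refl refl, of "Fp.pre_sigma (\<tau> k)" "Fx.pre_sigma (\<tau> k)" "count_space UNIV"]
    by (auto simp: Fp.space_pre_sigma Fx.space_pre_sigma)
  moreover have "AE \<omega> in cprob G x. \<exists>k. \<tau> k \<omega> = \<infinity>"
    using finitely_many_switches by (rule m.AE_mix) measurable
  moreover have "(\<integral>\<^sup>+\<omega>. number_of_switches \<tau> \<omega> \<partial>cprob G x) < \<infinity>"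
    using number_of_switches_H expected_switches_finite by (rule m.nn_integral_finite_mix)
  moreover have "number_of_switches \<tau> \<in> borel_measurable (cprob G x)"
    using m.subalg(2) number_of_switches_H by (rule measurable_from_subalg)
  note switching_cost_comparable[OF x switch_times(3) horizon_nonneg this, of \<xi>]
  ultimately show ?thesis
    unfolding admissible_def using stop switch_times by blast
qed

lemma performance_mixture:
  assumes "measure_mixture H (cprob G p) (cprob G x) (cprob G y) u v"
  shows "performance G T p (\<tau>, \<xi>) = u * performance G T x (\<tau>, \<xi>) + v * performance G T y (\<tau>, \<xi>)"
  unfolding performance_eq using assms _ integrable_payoff
  by (rule measure_mixture.integral_mix) measurable

end

theorem mainTheorem3:
  fixes G :: "('w, 's::finite, 'd::finite, 'p::finite) model"
    and T :: real and a :: 'p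
  assumes "switching_model G"
    and "0 \<le> T"
  shows "convex_on belief_simplex (\<lambda>p. value_fn G T p a)"
proof
  interpret switching_model G by fact
  obtain C where C: "0 \<le> C" "\<And>i b. \<bar>benefit G i b\<bar> \<le> C" using benefit_bound by blast
  have bdd: "bdd_above (performance G T q ` admissible G T q a)" if "q \<in> belief_simplex" for q
  proof (rule bdd_aboveI2)
    fix s assume "s \<in> admissible G T q a"
    then interpret admissible_strategy G T q a "fst s" "snd s"
      using that assms(2) by unfold_locales auto
    show "performance G T q s \<le> C * T" using performance_le[OF C] by simp
  qed
  \<comment> \<open>The introduction rule for \<open>convex_on\<close> asks only for
    \<open>0 < t < 1\<close>, so both weights are positive, as the passage of null sets to the
    components requires.\<close>
  fix t :: real and x y :: "real^'s"
  assume t: "t > 0" "t < 1" and x: "x \<in> belief_simplex" and y: "y \<in> belief_simplex"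
  let ?p = "(1 - t) *\<^sub>R x + t *\<^sub>R y"
  have p: "?p \<in> belief_simplex"
    using convexD[OF convex_belief_simplex x y, of "1 - t" t] t by simp
  have w: "0 < 1 - t" "0 < t" "1 - t + t = 1" "t + (1 - t) = 1" using t by auto
  have mix: "measure_mixture (augmented_source ?p) (cprob G ?p) (cprob G x) (cprob G y) (1 - t) t"
    using x y w(1-3) by (rule completed_law_mixture)
  have nullx: "obs_null_sets G ?p \<subseteq> obs_null_sets G x"
    using x y w(1-3) p by (rule obs_null_sets_mixture)
  have nully: "obs_null_sets G ?p \<subseteq> obs_null_sets G y"
    using obs_null_sets_mixture[OF y x w(2,1,4)] p by (simp add: add.commute)
  show "value_fn G T ?p a \<le> (1 - t) * value_fn G T x a + t * value_fn G T y a"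
    unfolding value_fn_def[of G T ?p a]
  proof (rule cSUP_least)
    show "admissible G T ?p a \<noteq> {}" using never_switch_admissible[OF assms(2)] by blast
    fix s assume "s \<in> admissible G T ?p a"
    then interpret admissible_strategy G T ?p a "fst s" "snd s"
      using p assms(2) by unfold_locales auto
    have "s \<in> admissible G T x a" "s \<in> admissible G T y a"
      using admissible_component[OF mix x nullx]
        admissible_component[OF measure_mixture.swap[OF mix] y nully] by simp_all
    then have "performance G T x s \<le> value_fn G T x a" "performance G T y s \<le> value_fn G T y a"
      unfolding value_fn_def using bdd x y by (auto intro!: cSUP_upper)
    then have "(1 - t) * performance G T x s + t * performance G T y s
        \<le> (1 - t) * value_fn G T x a + t * value_fn G T y a"
      using t by (intro add_mono mult_left_mono) auto
    then show "performance G T ?p s \<le> (1 - t) * value_fn G T x a + t * value_fn G T y a"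
      using performance_mixture[OF mix] by simp
  qed
qed (rule convex_belief_simplex)

end
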